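(* Let $F:\mathbb{R}^n\rightrightarrows\mathbb{R}^n$ be upper semicontinuous with nonempty compact values. Let $f:\mathbb{R}^n\to\mathbb{R}$ be a (locally Lipschitz) potential of a conservative field $D:\mathbb{R}^n\rightrightarrows\mathbb{R}^n$ such that for every $\widehat{x}\in\mathbb{R}^n$ there exist $\rho\in(0,\infty)$ and $\kappa\in\mathcal{P}$ with $$\forall x\in B_\rho(\widehat{x}),\quad \max_{u\in\mathrm{co}\,F(x)}\ \min_{v\in D(x)}\langle u,v\rangle\leq-\min_{w\in D(x)}\kappa(w),$$ and such that, for some $\overline{\ell}>0$, no $x\in\mathbb{R}^n$ satisfies both $0\in D(x)$ and $f(x)\in(0,\overline{\ell})$. Assume $\min f=0$. Let $p\in[1,\infty)$ and suppose: (i) $g:\mathbb{R}^n\to\mathbb{R}\cup\{\infty\}$ is continuous near $\arg\min f$ (i.e., on a neighborhood of $\arg\min f$) with $\min g=0$; (ii) $g$ is d-Lyapunov (resp. $p$-d-Lyapunov) near every point in $\arg\min f\cap\{x:g(x)>0\}$ near $\arg\min(f+g)$; that is, there is a neighborhood $U$ of $\arg\min(f+g)$ such that every point of $\arg\min f\cap\{x: g(x)>0\}\cap U$ has a neighborhood on which $g$ is d-Lyapunov (resp. $p$-d-Lyapunov) for $F$; (iii) $\arg\min(f+g)$ is bounded. Then $\arg\min(f+g)$ is d-stable (resp. asymptotically $p$-d-stable) for $F$.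
   Context: $|\cdot|=\sqrt{\langle\cdot,\cdot\rangle}$ is the Euclidean norm, $d(x,X)=\inf\{|x-y|:y\in X\}$, $B_r(X)=\{x:d(x,X)<r\}$ for a set $X$, $B_r(\widehat{x})$ is the open ball, $\mathrm{co}$ is the convex hull, $\mathbb{N}=\{0,1,2,\dots\}$. $F$ is upper semicontinuous if for every $x$ and every neighborhood $V$ of $F(x)$ there is a neighborhood $U$ of $x$ with $F(U)=\bigcup_{y\in U}F(y)\subseteq V$. $\mathcal{P}$ is the set of continuous functions $\kappa:\mathbb{R}^n\to\mathbb{R}$ with $\kappa(0)=0$ and $\kappa(x)>0$ for all $x\neq0$. Conservative field: given a locally Lipschitz function $f:\mathbb{R}^n\to\mathbb{R}$, a set-valued map $D:\mathbb{R}^n\rightrightarrows\mathbb{R}^n$ is a conservative field for $f$ (and $f$ is called a potential of $D$) if $D$ has a closed graph, nonempty compact values, and for every absolutely continuous curve $x:[0,1]\to\mathbb{R}^n$, for almost every $t\in(0,1)$ and for all $v\in D(x(t))$, $(f\circ x)'(t)=\langle v,x'(t)\rangle$. An Euler sequence of $F$ with step sizes $\{\alpha_k\}_{k\in\mathbb{N}}\subseteq(0,\infty)$ is a sequence $\{x_k\}_{k\in\mathbb{N}}\subseteq\mathbb{R}^n$ with $x_{k+1}\in x_k+\alpha_kF(x_k)$ for all $k\in\mathbb{N}$. d-Lyapunov: $g:\mathbb{R}^n\to\mathbb{R}\cup\{\infty\}$ is d-Lyapunov on $U\subseteq\mathbb{R}^n$ if there exists $\overline{\alpha}>0$ such that for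 all $\{\alpha_k\}_{k\in\mathbb{N}}\subseteq(0,\overline{\alpha}]$, all Euler sequences $\{x_k\}$ with these step sizes, and all $k\in\mathbb{N}$: $x_k\in U\Rightarrow g(x_{k+1})\leq g(x_k)$. $p$-d-Lyapunov: $g$ is $p$-d-Lyapunov on $U\subseteq\mathbb{R}^n$ if there exist $\overline{\alpha},\omega>0$ such that for all $\alpha\in(0,\overline{\alpha}]$, $x\in U$, $u\in F(x)$: $g(x+\alpha u)-g(x)\leq-\omega\alpha^p$. d-stable set: $X\subseteq\mathbb{R}^n$ is d-stable if for every $\epsilon>0$ there exist $\delta,\overline{\alpha}>0$ such that for all $\{\alpha_k\}_{k\in\mathbb{N}}\subseteq(0,\overline{\alpha}]$ and all Euler sequences $\{x_k\}$ with these step sizes: $x_0\in B_\delta(X)\Rightarrow\{x_k\}_{k\in\mathbb{N}}\subseteq B_\epsilon(X)$. Asymptotically $p$-d-stable set: $X$ is asymptotically $p$-d-stable if it is d-stable and there exist $\delta_0,\overline{\alpha}_0>0$ such that for all $\{\alpha_k\}_{k\in\mathbb{N}}\subseteq(0,\overline{\alpha}_0]$ with $\sum_{k=0}^\infty\alpha_k^p=\infty$ and $\alpha_k\to0$, and all Euler sequences $\{x_k\}$ with these step sizes: $x_0\in B_{\delta_0}(X)\Rightarrow d(x_k,X)\to0$.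
   Formalization: The formal theorem additionally assumes argmin(f+g) ⊆ argmin f; without it the claim fails, e.g. n=1, F(x)={-x}, f(x)=x²/2, D(x)={x}, g(x)=2|x-1|, where argmin(f+g)={1} is not d-stable. *)

theory Defs
  imports "HOL-Analysis.Analysis"
begin

(* Set-valued maps are functions into sets. Minima and maxima of continuous functions over
   nonempty compact values are written as INF and SUP, which are attained there. *)

(* The library's infdist x {} is 0 rather than infinity. For X = {} the two stability
   notions below hold with either convention. *)
definition tube :: "real \<Rightarrow> 'a::euclidean_space set \<Rightarrow> 'a set" where
  "tube r X = {x. infdist x X < r}"

definition upper_semicontinuous :: "('a::euclidean_space \<Rightarrow> 'a set) \<Rightarrow> bool" where
  "upper_semicontinuous F \<longleftrightarrow>
     (\<forall>x V. open V \<and> F x \<subseteq> V \<longrightarrow> (\<exists>U. open U \<and> x \<in> U \<and> (\<Union>y\<in>U. F y) \<subseteq> V))"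

definition class_P :: "('a::euclidean_space \<Rightarrow> real) set" where
  "class_P = {\<kappa>. continuous_on UNIV \<kappa> \<and> \<kappa> 0 = 0 \<and> (\<forall>x. x \<noteq> 0 \<longrightarrow> 0 < \<kappa> x)}"

definition locally_lipschitz :: "('a::euclidean_space \<Rightarrow> real) \<Rightarrow> bool" where
  "locally_lipschitz f \<longleftrightarrow> (\<forall>x. \<exists>r>0. \<exists>L. L-lipschitz_on (ball x r) f)"

definition abs_continuous_curve :: "(real \<Rightarrow> 'a::euclidean_space) \<Rightarrow> bool" where
  "abs_continuous_curve x \<longleftrightarrow>
     (\<forall>\<epsilon>>0. \<exists>\<delta>>0. \<forall>(N::nat) a b.
        (\<forall>i<N. 0 \<le> a i \<and> a i \<le> b i \<and> b i \<le> 1) \<and>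
        disjoint_family_on (\<lambda>i. {a i<..<b i}) {..<N} \<and>
        (\<Sum>i<N. b i - a i) < \<delta>
        \<longrightarrow> (\<Sum>i<N. norm (x (b i) - x (a i))) < \<epsilon>)"

(* The existence of x'(t) for almost every t is automatic for absolutely continuous x;
   it is stated so that the chain rule has a meaning. *)
definition conservative_field ::
    "('a::euclidean_space \<Rightarrow> real) \<Rightarrow> ('a \<Rightarrow> 'a set) \<Rightarrow> bool" where
  "conservative_field f D \<longleftrightarrow>
     locally_lipschitz f \<and>
     closed {(x, v). v \<in> D x} \<and>
     (\<forall>x. D x \<noteq> {} \<and> compact (D x)) \<and>
     (\<forall>x. abs_continuous_curve x \<longrightarrow>
        (AE t in lebesgue. t \<in> {0<..<1} \<longrightarrow>
           (\<exists>x'. (x has_vector_derivative x') (at t) \<and>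
                 (\<forall>v\<in>D (x t). ((f \<circ> x) has_real_derivative (v \<bullet> x')) (at t)))))"

definition euler_sequence ::
    "('a::euclidean_space \<Rightarrow> 'a set) \<Rightarrow> (nat \<Rightarrow> real) \<Rightarrow> (nat \<Rightarrow> 'a) \<Rightarrow> bool" where
  "euler_sequence F \<alpha> x \<longleftrightarrow> (\<forall>k. \<exists>u\<in>F (x k). x (Suc k) = x k + \<alpha> k *\<^sub>R u)"

definition d_lyapunov_on ::
    "('a::euclidean_space \<Rightarrow> 'a set) \<Rightarrow> ('a \<Rightarrow> ereal) \<Rightarrow> 'a set \<Rightarrow> bool" where
  "d_lyapunov_on F g U \<longleftrightarrow>
     (\<exists>\<alpha>max>0. \<forall>\<alpha> x. (\<forall>k. 0 < \<alpha> k \<and> \<alpha> k \<le> \<alpha>max) \<and> euler_sequence F \<alpha> x \<longrightarrow>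
        (\<forall>k. x k \<in> U \<longrightarrow> g (x (Suc k)) \<le> g (x k)))"

(* In ereal, \<infinity> - \<infinity> = \<infinity>, so the inequality fails where both values are infinite. *)
definition p_d_lyapunov_on ::
    "real \<Rightarrow> ('a::euclidean_space \<Rightarrow> 'a set) \<Rightarrow> ('a \<Rightarrow> ereal) \<Rightarrow> 'a set \<Rightarrow> bool" where
  "p_d_lyapunov_on p F g U \<longleftrightarrow>
     (\<exists>\<alpha>max>0. \<exists>\<omega>>0. \<forall>\<alpha> x u. 0 < \<alpha> \<and> \<alpha> \<le> \<alpha>max \<and> x \<in> U \<and> u \<in> F x \<longrightarrow>
        g (x + \<alpha> *\<^sub>R u) - g x \<le> - ereal (\<omega> * \<alpha> powr p))"

definition d_stable :: "('a::euclidean_space \<Rightarrow> 'a set) \<Rightarrow> 'a set \<Rightarrow> bool" where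
  "d_stable F X \<longleftrightarrow>
     (\<forall>\<epsilon>>0. \<exists>\<delta>>0. \<exists>\<alpha>max>0. \<forall>\<alpha> x.
        (\<forall>k. 0 < \<alpha> k \<and> \<alpha> k \<le> \<alpha>max) \<and> euler_sequence F \<alpha> x \<and> x 0 \<in> tube \<delta> X
        \<longrightarrow> range x \<subseteq> tube \<epsilon> X)"

(* The step sizes are positive, so divergence of the series is non-summability. *)
definition asymptotically_p_d_stable ::
    "real \<Rightarrow> ('a::euclidean_space \<Rightarrow> 'a set) \<Rightarrow> 'a set \<Rightarrow> bool" where
  "asymptotically_p_d_stable p F X \<longleftrightarrow>
     d_stable F X \<and>
     (\<exists>\<delta>>0. \<exists>\<alpha>max>0. \<forall>\<alpha> x.
        (\<forall>k. 0 < \<alpha> k \<and> \<alpha> k \<le> \<alpha>max) \<and> \<not> summable (\<lambda>k. \<alpha> k powr p) \<and> \<alpha> \<longlonglongrightarrow> 0 \<and>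
        euler_sequence F \<alpha> x \<and> x 0 \<in> tube \<delta> X
        \<longrightarrow> (\<lambda>k. infdist (x k) X) \<longlonglongrightarrow> 0)"

definition argmin :: "('a \<Rightarrow> 'b::linorder) \<Rightarrow> 'a set" where
  "argmin h = {x. \<forall>y. h x \<le> h y}"

definition has_minimum :: "('a \<Rightarrow> 'b::linorder) \<Rightarrow> 'b \<Rightarrow> bool" where
  "has_minimum h m \<longleftrightarrow> (\<exists>x. h x = m) \<and> (\<forall>x. m \<le> h x)"

end

theory Submission
  imports Defs "HOL-Complex_Analysis.Great_Picard"
begin

text \<open>
  Put \<open>c = min (f + g)\<close>, \<open>X = argmin (f + g) = {f = 0, g = c}\<close> and \<open>G = g - c\<close>, and let \<open>N\<close> be a
  compact tube around \<open>X\<close> on which \<open>f < l\<close>. Euler polygons with vanishing steps converge to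
  solutions of \<open>x' \<in> co F(x)\<close>, and by the chain rule \<open>f\<close> strictly decreases along solutions inside
  \<open>{0 < f < l}\<close>. By compactness, Euler sequences with small steps lose a definite amount of \<open>f\<close> over
  a fixed time as long as they stay in \<open>N \<inter> {f \<ge> a}\<close>, so \<open>{f \<le> \<mu>/2}\<close> cannot be left through
  \<open>{f > \<mu>}\<close> inside \<open>N\<close>. Where \<open>f\<close> is small and \<open>G \<ge> \<eta>\<close>, the Lyapunov condition on \<open>g\<close> applies with
  uniform constants, so \<open>G\<close> stays small as well; and \<open>f\<close> and \<open>G\<close> are both small only near \<open>X\<close>.
  In the asymptotic case \<open>f\<close> tends to \<open>0\<close> because \<open>\<Sum>\<alpha>\<^sub>k = \<infinity>\<close>, and then \<open>limsup G \<le> 0\<close> because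
  \<open>\<Sum>\<alpha>\<^sub>k\<^sup>p = \<infinity>\<close>.
\<close>

subsection \<open>Lipschitz functions and Euler polygons\<close>

text \<open>The Lipschitz bound sends the exceptional null set to a null set of values. Hence
  between two values there is a level that is attained at interior points only where the derivative
  is negative, and such a level cannot be crossed upwards for a last time.\<close>

lemma lipschitz_ae_neg_deriv_imp_less:
  fixes \<phi> :: "real \<Rightarrow> real"
  assumes lip: "L-lipschitz_on {a..b} \<phi>" and "a < b"
    and ae: "AE t in lebesgue. t \<in> {a<..<b} \<longrightarrow> (\<exists>d<0. (\<phi> has_real_derivative d) (at t))"
  shows "\<phi> b < \<phi> a"
proof -
  obtain N where N0: "N \<in> null_sets lebesgue"
    and N: "\<And>t. t \<in> {a<..<b} \<Longrightarrow> t \<notin> N \<Longrightarrow> \<exists>d<0. (\<phi> has_real_derivative d) (at t)"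
    using ae unfolding eventually_ae_filter by fastforce
  have neg: "negligible N" using N0 by (simp add: negligible_iff_null_sets)
  define N' where "N' = N \<inter> {a..b}"
  have "negligible N'" using neg by (simp add: N'_def negligible_Int)
  then have img: "negligible (\<phi> ` N')"
  proof (rule negligible_locally_Lipschitz_image[OF order_refl])
    fix x assume "x \<in> N'"
    then have "norm (\<phi> y - \<phi> x) \<le> L * norm (y - x)" if "y \<in> N'" for y
      using lipschitz_onD[OF lip, of y x] that by (auto simp: N'_def dist_norm)
    then show "\<exists>T B. open T \<and> x \<in> T \<and> (\<forall>y\<in>N' \<inter> T. norm (\<phi> y - \<phi> x) \<le> B * norm (y - x))"
      by (intro exI[of _ UNIV] exI[of _ L]) auto
  qed
  \<comment> \<open>Used twice: for a level among the values and for a time in the interval.\<close>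
  have gap: "\<exists>y. u < y \<and> y < v \<and> y \<notin> S" if "u < v" "negligible S" for u v :: real and S
    using that negligible_subset[of S "{u<..<v}"] open_not_negligible[of "{u<..<v}"] by force
  have cont: "continuous_on {a..b} \<phi>" using lip by (rule lipschitz_on_continuous_on)
  have mono: "\<phi> t \<le> \<phi> s" if st: "a \<le> s" "s < t" "t \<le> b" for s t
  proof (rule ccontr)
    assume "\<not> \<phi> t \<le> \<phi> s"
    then have "\<phi> s < \<phi> t" by simp
    from gap[OF this img] obtain y where y: "\<phi> s < y" "y < \<phi> t" "y \<notin> \<phi> ` N'" by blast
    \<comment> \<open>The maximum \<open>\<tau>\<close> of \<open>K\<close> is the last time in
      \<open>{s..t}\<close> with value at most \<open>y\<close>. Its value is exactly
      \<open>y\<close>, so the derivative there is negative and slightly later times also belong to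
      \<open>K\<close>.\<close>
    define K where "K = {r \<in> {s..t}. \<phi> r \<le> y}"
    have cst: "continuous_on {s..t} \<phi>" using cont by (rule continuous_on_subset) (use st in auto)
    have "closed K" unfolding K_def
      using continuous_on_closed_Collect_le[OF cst continuous_on_const, of y] by simp
    moreover have "bounded K" by (rule bounded_subset[of "{s..t}"]) (auto simp: K_def)
    moreover have "s \<in> K" using y st by (auto simp: K_def)
    ultimately obtain \<tau> where \<tau>: "\<tau> \<in> K" "\<And>r. r \<in> K \<Longrightarrow> r \<le> \<tau>"
      using compact_attains_sup[of K] by (metis compact_eq_bounded_closed empty_iff)
    have "\<tau> < t" using \<tau>(1) y by (auto simp: K_def order_le_less)
    have "\<phi> \<tau> = y"
    proof (rule ccontr)
      assume "\<phi> \<tau> \<noteq> y"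
      then have "\<phi> \<tau> < y" using \<tau> by (auto simp: K_def)
      moreover have "continuous_on {\<tau>..t} \<phi>"
        using cst by (rule continuous_on_subset) (use \<tau> in \<open>auto simp: K_def\<close>)
      ultimately obtain r where "\<tau> \<le> r" "r \<le> t" "\<phi> r = y"
        using IVT'[of \<phi> \<tau> y t] y \<open>\<tau> < t\<close> by auto
      then show False using \<tau>(2)[of r] \<tau>(1) \<open>\<phi> \<tau> < y\<close> by (auto simp: K_def)
    qed
    moreover have "\<tau> \<noteq> s" using y \<open>\<phi> \<tau> = y\<close> by auto
    ultimately have "\<tau> \<in> {a<..<b}" "\<tau> \<notin> N"
      using \<tau>(1) y st \<open>\<tau> < t\<close> by (auto simp: K_def N'_def)
    then obtain d where "d < 0" "(\<phi> has_real_derivative d) (at \<tau>)" using N by blast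
    from DERIV_neg_dec_right[OF this(2,1)] obtain e where
      e: "e > 0" "\<And>h. 0 < h \<Longrightarrow> h < e \<Longrightarrow> \<phi> (\<tau> + h) < \<phi> \<tau>" by blast
    define h where "h = min (e / 2) (t - \<tau>)"
    have "0 < h" "h < e" using e(1) \<open>\<tau> < t\<close> by (auto simp: h_def)
    then have "\<tau> + h \<in> K" using e(2)[of h] \<tau>(1) \<open>\<phi> \<tau> = y\<close> by (auto simp: K_def h_def)
    then show False using \<tau>(2)[of "\<tau> + h"] \<open>0 < h\<close> by simp
  qed
  \<comment> \<open>Monotonicity gives only a weak inequality; a single interior point with negative
    derivative makes it strict.\<close>
  obtain t where t: "a < t" "t < b" "t \<notin> N" using gap[OF \<open>a < b\<close> neg] by blast
  then obtain d where "d < 0" "(\<phi> has_real_derivative d) (at t)" using N by auto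
  from DERIV_neg_dec_right[OF this(2,1)] obtain e where
    e: "e > 0" "\<And>h. 0 < h \<Longrightarrow> h < e \<Longrightarrow> \<phi> (t + h) < \<phi> t" by blast
  define h where "h = min (e / 2) ((b - t) / 2)"
  have h: "0 < h" "h < e" "t + h < b" using e(1) t by (auto simp: h_def min_def field_simps)
  have "\<phi> b \<le> \<phi> (t + h)" using mono[of "t + h" b] h t by auto
  also have "\<dots> < \<phi> t" using e h by blast
  also have "\<dots> \<le> \<phi> a" using mono[of a t] t by auto
  finally show ?thesis .
qed

text \<open>The curve is the piecewise linear interpolation of the iterates at the times
  \<open>\<Sum>j<i. \<alpha> j\<close>; its difference quotients are convex combinations of the velocities
  used in the meantime.\<close>
lemma euler_polygon:
  fixes F :: "'a::euclidean_space \<Rightarrow> 'a set"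
  assumes step: "\<And>i. i < k \<Longrightarrow> 0 < \<alpha> i \<and> \<alpha> i \<le> e"
    and euler: "\<And>i. i < k \<Longrightarrow> \<exists>u\<in>F (x i). x (Suc i) = x i + \<alpha> i *\<^sub>R u"
    and bound: "\<And>i u. i < k \<Longrightarrow> u \<in> F (x i) \<Longrightarrow> norm u \<le> M"
    and T: "0 < T" "T \<le> (\<Sum>i<k. \<alpha> i)" "(\<Sum>i<k. \<alpha> i) \<le> T + e"
  obtains y where "y 0 = x 0" "norm (y T - x k) \<le> M * e"
    "\<And>s s'. \<lbrakk>0 \<le> s; s \<le> s'; s' \<le> T\<rbrakk> \<Longrightarrow> norm (y s' - y s) \<le> M * (s' - s)"
    "\<And>s. \<lbrakk>0 \<le> s; s \<le> T\<rbrakk> \<Longrightarrow> \<exists>i\<le>k. norm (y s - x i) \<le> M * e"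
    "\<And>s s' V. \<lbrakk>0 \<le> s; s < s'; s' \<le> T; convex V;
        \<And>z. norm (z - y s) \<le> M * (s' - s + e) \<Longrightarrow> F z \<subseteq> V\<rbrakk>
      \<Longrightarrow> (y s' - y s) /\<^sub>R (s' - s) \<in> V"
proof -
  obtain u where u: "\<And>i. i < k \<Longrightarrow> u i \<in> F (x i)" "\<And>i. i < k \<Longrightarrow> x (Suc i) = x i + \<alpha> i *\<^sub>R u i"
    using euler by metis
  define t where "t i = (\<Sum>j<i. \<alpha> j)" for i
  \<comment> \<open>For \<open>0 \<le> s\<close>, \<open>w s i\<close> is the part of the
    \<open>i\<close>-th step interval that has elapsed by time \<open>s\<close>.\<close>
  define w where "w s i = min s (t (Suc i)) - min s (t i)" for s i
  define y where "y s = x 0 + (\<Sum>i<k. w s i *\<^sub>R u i)" for s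
  have tS: "t (Suc i) = t i + \<alpha> i" for i by (simp add: t_def)
  have t0: "t 0 = 0" by (simp add: t_def)
  have tmono: "t i \<le> t j" if "i \<le> j" "j \<le> k" for i j
    unfolding t_def by (rule sum_mono2) (use that step in \<open>auto intro: less_imp_le\<close>)
  have tpos: "0 \<le> t i" if "i \<le> k" for i using tmono[of 0 i] that t0 by simp
  have tk: "T \<le> t k" "t k \<le> T + e" using T by (simp_all add: t_def)
  have wmono: "w s i \<le> w s' i" if "i < k" "s \<le> s'" for i s s'
    using that step[of i] by (auto simp: w_def tS min_def)
  have wsum: "(\<Sum>i<k. w s i) = s" if "0 \<le> s" "s \<le> t k" for s
    using that sum_lessThan_telescope[of "\<lambda>i. min s (t i)" k] by (simp add: w_def t0 min_def)
  have "k \<noteq> 0" using T by (cases k) auto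
  then have "0 < e" using step[of 0] by auto
  have M0: "0 \<le> M" using bound[of 0 "u 0"] u(1)[of 0] \<open>k \<noteq> 0\<close> norm_ge_zero[of "u 0"] by linarith
  have conv: "(y s' - y s) /\<^sub>R (s' - s) \<in> V"
    if s: "0 \<le> s" "s < s'" "s' \<le> t k" and V: "convex V"
      and uV: "\<And>i. \<lbrakk>i < k; t i < s'; s < t (Suc i)\<rbrakk> \<Longrightarrow> u i \<in> V" for s s' V
  proof -
    \<comment> \<open>These are the steps active during \<open>(s, s')\<close>. The times spent in
      them, divided by \<open>s' - s\<close>, are the weights of a convex combination of
      velocities.\<close>
    define I where "I = {i. i < k \<and> t i < s' \<and> s < t (Suc i)}"
    have zero: "w s' i - w s i = 0" if "i < k" "i \<notin> I" for i
      using that s step[of i] by (auto simp: I_def w_def tS min_def)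
    have sub: "(\<Sum>i\<in>I. h i) = (\<Sum>i<k. h i)" if "\<And>i. i < k \<Longrightarrow> i \<notin> I \<Longrightarrow> h i = 0"
      for h :: "nat \<Rightarrow> 'c::comm_monoid_add"
      by (rule sum.mono_neutral_left) (use that in \<open>auto simp: I_def\<close>)
    have "(\<Sum>i\<in>I. ((w s' i - w s i) / (s' - s)) *\<^sub>R u i) \<in> V"
    proof (rule convex_sum[OF _ V])
      show "finite I" by (simp add: I_def)
      have "(\<Sum>i\<in>I. (w s' i - w s i) / (s' - s)) = (\<Sum>i<k. (w s' i - w s i) / (s' - s))"
        by (rule sub) (use zero in auto)
      also have "\<dots> = ((\<Sum>i<k. w s' i) - (\<Sum>i<k. w s i)) / (s' - s)"
        by (simp add: sum_divide_distrib[symmetric] sum_subtractf)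
      also have "\<dots> = 1" using wsum[of s] wsum[of s'] s by simp
      finally show "(\<Sum>i\<in>I. (w s' i - w s i) / (s' - s)) = 1" .
      show "0 \<le> (w s' i - w s i) / (s' - s)" if "i \<in> I" for i
        using wmono[of i s s'] that s by (simp add: I_def)
      show "u i \<in> V" if "i \<in> I" for i using that uV by (auto simp: I_def)
    qed
    also have "(\<Sum>i\<in>I. ((w s' i - w s i) / (s' - s)) *\<^sub>R u i)
        = (\<Sum>i<k. ((w s' i - w s i) / (s' - s)) *\<^sub>R u i)"
      by (rule sub) (use zero in auto)
    also have "\<dots> = (y s' - y s) /\<^sub>R (s' - s)"
      by (simp add: y_def sum_subtractf[symmetric] scaleR_sum_right scaleR_diff_left[symmetric]
          divide_inverse mult.commute)
    finally show ?thesis .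
  qed
  \<comment> \<open>The speed bound is the case of \<open>conv\<close> in which \<open>V\<close> is
    the ball of radius \<open>M\<close>.\<close>
  have lip: "norm (y s' - y s) \<le> M * (s' - s)" if "0 \<le> s" "s \<le> s'" "s' \<le> t k" for s s'
  proof (cases "s = s'")
    case False
    then have "s < s'" using that by simp
    then have "(y s' - y s) /\<^sub>R (s' - s) \<in> cball 0 M"
      by (intro conv) (use that u(1) bound in auto)
    then have "norm (y s' - y s) / (s' - s) \<le> M"
      using \<open>s < s'\<close> by (simp add: divide_inverse mult.commute)
    then show ?thesis using \<open>s < s'\<close> by (simp add: pos_divide_le_eq)
  qed simp
  have yt: "y (t j) = x j" if "j \<le> k" for j
  proof -
    have w1: "w (t j) i = (if i < j then \<alpha> i else 0)" if "i < k" for i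
    proof (cases "i < j")
      case True
      then show ?thesis using tmono[of i j] tmono[of "Suc i" j] \<open>j \<le> k\<close> by (auto simp: w_def tS)
    next
      case False
      then show ?thesis using tmono[of j i] tmono[of j "Suc i"] \<open>i < k\<close> by (auto simp: w_def tS)
    qed
    have "(\<Sum>i<k. w (t j) i *\<^sub>R u i) = (\<Sum>i<k. if i < j then \<alpha> i *\<^sub>R u i else 0)"
      by (rule sum.cong) (auto simp: w1)
    also have "\<dots> = (\<Sum>i<j. \<alpha> i *\<^sub>R u i)"
      by (rule sum.mono_neutral_cong_right) (use \<open>j \<le> k\<close> in auto)
    also have "\<dots> = (\<Sum>i<j. x (Suc i) - x i)"
      by (rule sum.cong) (use u(2) \<open>j \<le> k\<close> in auto)
    also have "\<dots> = x j - x 0" by (rule sum_lessThan_telescope)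
    finally show ?thesis by (simp add: y_def)
  qed
  show thesis
  proof (rule that[of y])
    show "y 0 = x 0" using yt[of 0] t0 by simp
    have "norm (y (t k) - y T) \<le> M * (t k - T)" by (rule lip) (use T tk in auto)
    also have "\<dots> \<le> M * e" using M0 tk by (intro mult_left_mono) auto
    finally show "norm (y T - x k) \<le> M * e" using yt[of k] by (simp add: norm_minus_commute)
    show "norm (y s' - y s) \<le> M * (s' - s)" if "0 \<le> s" "s \<le> s'" "s' \<le> T" for s s'
      by (rule lip) (use that tk in auto)
    show "\<exists>i\<le>k. norm (y s - x i) \<le> M * e" if "0 \<le> s" "s \<le> T" for s
    proof -
      \<comment> \<open>The first grid time not before \<open>s\<close>; by minimality it is at most
        one step length later.\<close>
      define i where "i = (LEAST i. s \<le> t i)"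
      have ik: "i \<le> k" and si: "s \<le> t i"
        using Least_le[of "\<lambda>i. s \<le> t i" k] LeastI[of "\<lambda>i. s \<le> t i" k] that tk by (auto simp: i_def)
      have "t i - s \<le> e"
      proof (cases i)
        case 0 then show ?thesis using t0 that \<open>0 < e\<close> by simp
      next
        case (Suc j)
        then have "\<not> s \<le> t j" unfolding i_def by (metis lessI not_less_Least)
        then show ?thesis using Suc step[of j] ik tS[of j] by auto
      qed
      have "norm (y (t i) - y s) \<le> M * (t i - s)"
        by (rule lip) (use that si tmono[of i k] ik in auto)
      also have "\<dots> \<le> M * e" using M0 \<open>t i - s \<le> e\<close> by (intro mult_left_mono) auto
      finally show ?thesis using yt[of i] ik by (metis norm_minus_commute)
    qed
    show "(y s' - y s) /\<^sub>R (s' - s) \<in> V"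
      if s: "0 \<le> s" "s < s'" "s' \<le> T" "convex V"
        and FV: "\<And>z. norm (z - y s) \<le> M * (s' - s + e) \<Longrightarrow> F z \<subseteq> V" for s s' V
    proof (rule conv)
      fix i assume i: "i < k" "t i < s'" "s < t (Suc i)"
      \<comment> \<open>An active step starts before \<open>s'\<close> and ends after
        \<open>s\<close>, so its starting time differs from \<open>s\<close> by at most
        \<open>s' - s + e\<close>. This is where the radius in the hypothesis on \<open>V\<close>
        comes from.\<close>
      have "norm (x i - y s) \<le> M * \<bar>t i - s\<bar>"
      proof (cases "s \<le> t i")
        case True
        then show ?thesis using lip[of s "t i"] yt[of i] i s tmono[of i k] by simp
      next
        case False
        then show ?thesis using lip[of "t i" s] yt[of i] i s tk tpos[of i]
          by (simp add: norm_minus_commute)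
      qed
      also have "\<dots> \<le> M * (s' - s + e)"
        using M0 i step[of i] tS[of i] s by (intro mult_left_mono) auto
      finally show "u i \<in> V" using FV u(1) i by blast
    qed (use s tk in auto)
  qed
qed

section \<open>Compactness of Euler polygons with vanishing steps\<close>

lemma upper_semicontinuous_bounded:
  fixes F :: "'a::euclidean_space \<Rightarrow> 'a set"
  assumes usc: "upper_semicontinuous F" and val: "\<And>x. compact (F x)" and "compact N"
  obtains M where "0 < M" "\<And>x u. x \<in> N \<Longrightarrow> u \<in> F x \<Longrightarrow> norm u \<le> M"
proof -
  have "\<exists>U B. open U \<and> x \<in> U \<and> (\<forall>y\<in>U. \<forall>u\<in>F y. norm u \<le> B)" for x
  proof -
    obtain B where "F x \<subseteq> ball 0 B"
      using compact_imp_bounded[OF val, of x] bounded_subset_ballD by blast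
    then obtain U where "open U" "x \<in> U" "(\<Union>y\<in>U. F y) \<subseteq> ball 0 B"
      using usc unfolding upper_semicontinuous_def by (metis open_ball)
    then show ?thesis by (intro exI[of _ U] exI[of _ B]) (auto simp: subset_iff less_imp_le)
  qed
  then obtain U B where UB: "\<And>x. open (U x)" "\<And>x. x \<in> U x"
    "\<And>x y u. y \<in> U x \<Longrightarrow> u \<in> F y \<Longrightarrow> norm u \<le> B x" by metis
  obtain C where C: "C \<subseteq> N" "finite C" "N \<subseteq> (\<Union>x\<in>C. U x)"
    using compactE_image[OF \<open>compact N\<close>, of N U] UB(1,2) by blast
  define M where "M = 1 + (\<Sum>x\<in>C. \<bar>B x\<bar>)"
  show thesis
  proof (rule that[of M])
    show "0 < M" unfolding M_def by (simp add: add_pos_nonneg sum_nonneg)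
    show "norm u \<le> M" if xu: "x \<in> N" "u \<in> F x" for x u
    proof -
      obtain c where c: "c \<in> C" "x \<in> U c" using C xu by blast
      have "norm u \<le> \<bar>B c\<bar>" using UB(3)[OF c(2) xu(2)] by simp
      also have "\<dots> \<le> (\<Sum>x\<in>C. \<bar>B x\<bar>)" using c C by (intro member_le_sum) auto
      finally show ?thesis by (simp add: M_def)
    qed
  qed
qed

text \<open>The polygons share one Lipschitz constant, so Arzela-Ascoli yields a uniform limit. The
  inclusion for its derivative needs no weak convergence: difference quotients of the polygons lie
  in a convex neighbourhood of the hull, and its closed enlargement keeps them through the limit in
  the mesh and then through the limit in time.\<close>

lemma euler_limit:
  fixes F :: "'a::euclidean_space \<Rightarrow> 'a set" and x :: "nat \<Rightarrow> nat \<Rightarrow> 'a"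
  assumes usc: "upper_semicontinuous F" and val: "\<And>x. compact (F x)" "\<And>x. F x \<noteq> {}"
    and Z: "compact Z" and T: "0 < T"
    and step: "\<And>m i. i < k m \<Longrightarrow> 0 < \<alpha> m i \<and> \<alpha> m i \<le> 1 / Suc m"
    and euler: "\<And>m i. i < k m \<Longrightarrow> \<exists>u\<in>F (x m i). x m (Suc i) = x m i + \<alpha> m i *\<^sub>R u"
    and inZ: "\<And>m i. i \<le> k m \<Longrightarrow> x m i \<in> Z"
    and time: "\<And>m. T \<le> (\<Sum>i<k m. \<alpha> m i)" "\<And>m. (\<Sum>i<k m. \<alpha> m i) \<le> T + 1 / Suc m"
  obtains y M and r :: "nat \<Rightarrow> nat" where "strict_mono r" "M-lipschitz_on UNIV y" "\<And>s. y s \<in> Z"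
    "(\<lambda>m. x (r m) 0) \<longlonglongrightarrow> y 0" "(\<lambda>m. x (r m) (k (r m))) \<longlonglongrightarrow> y T"
    "\<And>t v. \<lbrakk>0 < t; t < T; (y has_vector_derivative v) (at t)\<rbrakk> \<Longrightarrow> v \<in> convex hull F (y t)"
proof -
  obtain M where M: "0 < M" "\<And>x u. x \<in> Z \<Longrightarrow> u \<in> F x \<Longrightarrow> norm u \<le> M"
    using upper_semicontinuous_bounded[OF usc val(1) Z] by blast
  let ?e = "\<lambda>m. 1 / real (Suc m)"
  have "\<exists>y. y 0 = x m 0 \<and> norm (y T - x m (k m)) \<le> M * ?e m \<and>
     (\<forall>s s'. 0 \<le> s \<longrightarrow> s \<le> s' \<longrightarrow> s' \<le> T \<longrightarrow> norm (y s' - y s) \<le> M * (s' - s)) \<and>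
     (\<forall>s. 0 \<le> s \<longrightarrow> s \<le> T \<longrightarrow> (\<exists>i\<le>k m. norm (y s - x m i) \<le> M * ?e m)) \<and>
     (\<forall>s s' V. 0 \<le> s \<longrightarrow> s < s' \<longrightarrow> s' \<le> T \<longrightarrow> convex V \<longrightarrow>
        (\<forall>z. norm (z - y s) \<le> M * (s' - s + ?e m) \<longrightarrow> F z \<subseteq> V)
      \<longrightarrow> (y s' - y s) /\<^sub>R (s' - s) \<in> V)" (is "\<exists>y. ?P m y") for m
  proof -
    have bd: "norm u \<le> M" if "i < k m" "u \<in> F (x m i)" for i u
      using that M(2) inZ[of i m] by simp
    show ?thesis
    proof (rule euler_polygon[of "k m" "\<alpha> m" "?e m" F "x m" M T, OF step euler bd T time(1) time(2)])
      fix y assume "y 0 = x m 0" "norm (y T - x m (k m)) \<le> M * ?e m"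
        "\<And>s s'. \<lbrakk>0 \<le> s; s \<le> s'; s' \<le> T\<rbrakk> \<Longrightarrow> norm (y s' - y s) \<le> M * (s' - s)"
        "\<And>s. \<lbrakk>0 \<le> s; s \<le> T\<rbrakk> \<Longrightarrow> \<exists>i\<le>k m. norm (y s - x m i) \<le> M * ?e m"
        "\<And>s s' V. \<lbrakk>0 \<le> s; s < s'; s' \<le> T; convex V;
            \<And>z. norm (z - y s) \<le> M * (s' - s + ?e m) \<Longrightarrow> F z \<subseteq> V\<rbrakk>
          \<Longrightarrow> (y s' - y s) /\<^sub>R (s' - s) \<in> V"
      then have "?P m y" by (intro conjI allI impI) blast+
      then show ?thesis by blast
    qed
  qed
  from choice[OF allI[OF this]] obtain Y where Y: "\<forall>m. ?P m (Y m)" ..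
  have Y0: "Y m 0 = x m 0" and YT: "norm (Y m T - x m (k m)) \<le> M * ?e m" for m using Y by blast+
  have Ylip: "norm (Y m s' - Y m s) \<le> M * (s' - s)" if "0 \<le> s" "s \<le> s'" "s' \<le> T" for m s s'
    using Y that by blast
  have Yx: "\<exists>i\<le>k m. norm (Y m s - x m i) \<le> M * ?e m" if "0 \<le> s" "s \<le> T" for m s
    using Y that by blast
  have YV: "(Y m s' - Y m s) /\<^sub>R (s' - s) \<in> V" if "0 \<le> s" "s < s'" "s' \<le> T" "convex V"
    "\<forall>z. norm (z - Y m s) \<le> M * (s' - s + ?e m) \<longrightarrow> F z \<subseteq> V" for m s s' V
    using Y that by blast
  have Ylip': "norm (Y m s - Y m s') \<le> M * \<bar>s - s'\<bar>" if "s \<in> {0..T}" "s' \<in> {0..T}" for m s s'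
    using Ylip[of s s' m] Ylip[of s' s m] that by (cases "s \<le> s'") (auto simp: norm_minus_commute)
  have elim: "(\<lambda>m. M * ?e m) \<longlonglongrightarrow> 0"
    using tendsto_mult_left[OF LIMSEQ_Suc[OF lim_1_over_n], of M] by simp
  obtain B where B: "\<And>z. z \<in> Z \<Longrightarrow> norm z \<le> B"
    using compact_imp_bounded[OF Z] bounded_iff by blast
  have Ybd: "norm (Y m s) \<le> B + M" if s: "s \<in> {0..T}" for m s
  proof -
    obtain i where "i \<le> k m" "norm (Y m s - x m i) \<le> M * ?e m" using Yx[of s m] s by auto
    moreover have "M * ?e m \<le> M" using M by (simp add: field_simps)
    ultimately show ?thesis using B[OF inZ] norm_triangle_sub[of "Y m s" "x m i"] by force
  qed
  have equi: "\<exists>d>0. \<forall>n s'. s' \<in> {0..T} \<and> norm (s - s') < d \<longrightarrow> norm (Y n s - Y n s') < e"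
    if s: "s \<in> {0..T}" "0 < e" for s e
  proof (intro exI conjI allI impI)
    show "0 < e / M" using s M by simp
    fix n s' assume s': "s' \<in> {0..T} \<and> norm (s - s') < e / M"
    have "norm (Y n s - Y n s') \<le> M * \<bar>s - s'\<bar>" using Ylip'[of s s' n] s s' by blast
    also have "\<dots> < M * (e / M)" using M s' by (intro mult_strict_left_mono) auto
    finally show "norm (Y n s - Y n s') < e" using M by simp
  qed
  obtain g r where r: "strict_mono (r :: nat \<Rightarrow> nat)"
    and g: "\<And>e. 0 < e \<Longrightarrow> \<exists>N. \<forall>n s. n \<ge> N \<and> s \<in> {0..T} \<longrightarrow> norm (Y (r n) s - g s) < e"
    using Arzela_Ascoli[of "{0..T}" Y "B + M", OF compact_Icc Ybd equi] by metis
  have glim: "(\<lambda>n. Y (r n) s) \<longlonglongrightarrow> g s" if "s \<in> {0..T}" for s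
    using g that by (intro LIMSEQ_I) blast
  have glip: "norm (g s - g s') \<le> M * \<bar>s - s'\<bar>" if "s \<in> {0..T}" "s' \<in> {0..T}" for s s'
    by (rule Lim_norm_ubound[OF _ tendsto_diff[OF glim[OF that(1)] glim[OF that(2)]]])
       (use Ylip' that in auto)
  \<comment> \<open>The limit is extended constantly outside \<open>{0..T}\<close>, so that it is a
    Lipschitz curve on the whole line with values in \<open>Z\<close>, as the chain rule for curves
    on [0,1] requires.\<close>
  define y where "y s = g (max 0 (min s T))" for s
  have yg: "y s = g s" if "s \<in> {0..T}" for s using that by (simp add: y_def)
  have elimr: "(\<lambda>m. M * ?e (r m)) \<longlonglongrightarrow> 0" using LIMSEQ_subseq_LIMSEQ[OF elim r] by (simp add: o_def)
  have Zclosed: "closed Z" using Z by (rule compact_imp_closed)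
  show thesis
  proof (rule that[of r M y])
    show "strict_mono r" by fact
    show "M-lipschitz_on UNIV y"
    proof (rule lipschitz_onI)
      fix s s' :: real
      have "dist (y s) (y s') \<le> M * \<bar>max 0 (min s T) - max 0 (min s' T)\<bar>"
        unfolding y_def dist_norm using T by (intro glip) auto
      also have "\<dots> \<le> M * dist s s'"
        using M by (intro mult_left_mono) (auto simp: dist_real_def max_def min_def)
      finally show "dist (y s) (y s') \<le> M * dist s s'" .
    qed (use M in simp)
    have gZ: "g s \<in> Z" if s: "s \<in> {0..T}" for s
    proof -
      have "\<forall>m. \<exists>i\<le>k (r m). norm (Y (r m) s - x (r m) i) \<le> M * ?e (r m)" using Yx s by auto
      then obtain i where i: "\<And>m. i m \<le> k (r m)"
        "\<And>m. norm (Y (r m) s - x (r m) (i m)) \<le> M * ?e (r m)" by metis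
      have "(\<lambda>m. Y (r m) s - x (r m) (i m)) \<longlonglongrightarrow> 0"
        by (rule Lim_null_comparison[OF _ elimr]) (use i in auto)
      from tendsto_diff[OF glim[OF s] this] have "(\<lambda>m. x (r m) (i m)) \<longlonglongrightarrow> g s" by simp
      moreover have "\<And>m. x (r m) (i m) \<in> Z" by (rule inZ[OF i(1)])
      ultimately show ?thesis using closed_sequentially[OF Zclosed, of "\<lambda>m. x (r m) (i m)"] by simp
    qed
    show "y s \<in> Z" for s unfolding y_def using T by (intro gZ) auto
    show "(\<lambda>m. x (r m) 0) \<longlonglongrightarrow> y 0" using glim[of 0] T yg[of 0] by (simp add: Y0)
    have "(\<lambda>m. Y (r m) T - x (r m) (k (r m))) \<longlonglongrightarrow> 0"
      by (rule Lim_null_comparison[OF _ elimr]) (use YT in auto)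
    from tendsto_diff[OF glim[of T] this] show "(\<lambda>m. x (r m) (k (r m))) \<longlonglongrightarrow> y T"
      using T yg[of T] by simp
    show "v \<in> convex hull F (y t)"
      if t: "0 < t" "t < T" and der: "(y has_vector_derivative v) (at t)" for t v
    proof -
      define C where "C = convex hull F (y t)"
      have C: "closed C" "C \<noteq> {}" "convex C"
        unfolding C_def using val by (auto simp: compact_convex_hull compact_imp_closed)
      have "infdist v C \<le> e" if e: "0 < e" for e
      proof -
        \<comment> \<open>Open, so that upper semicontinuity applies, and convex as a sum of convex
          sets, so that it captures the difference quotients.\<close>
        define V where "V = (\<Union>c\<in>C. \<Union>b\<in>ball 0 e. {c + b})"
        have "open V" unfolding V_def by (rule open_sums) simp
        have "convex V" unfolding V_def by (rule convex_sums) (use C in auto)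
        have "F (y t) \<subseteq> V"
        proof
          fix u assume "u \<in> F (y t)"
          then have "u \<in> C" unfolding C_def by (rule hull_inc)
          then show "u \<in> V" unfolding V_def using e by force
        qed
        with \<open>open V\<close> usc obtain U where "open U" "y t \<in> U" and U: "(\<Union>z\<in>U. F z) \<subseteq> V"
          unfolding upper_semicontinuous_def by metis
        then obtain d where d: "0 < d" "ball (y t) d \<subseteq> U" using openE by metis
        have Vinf: "V \<subseteq> {z. infdist z C \<le> e}"
        proof
          fix z assume "z \<in> V"
          then obtain c b where "c \<in> C" "norm b < e" "z = c + b" by (auto simp: V_def)
          then show "z \<in> {z. infdist z C \<le> e}"
            using infdist_le[of c C z] by (simp add: dist_norm)
        qed
        have clo: "closed {z. infdist z C \<le> e}"
          by (intro closed_Collect_le continuous_intros)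
        \<comment> \<open>The elapsed time, the mesh size and the uniform error each contribute less
          than \<open>d / 3\<close>, so all values of \<open>F\<close> involved are taken inside
          \<open>U\<close>.\<close>
        have quot: "(y s - y t) /\<^sub>R (s - t) \<in> {z. infdist z C \<le> e}"
          if s: "t < s" "s < T" "M * (s - t) < d / 3" for s
        proof (rule Lim_in_closed_set[OF clo _ sequentially_bot])
          show "(\<lambda>m. (Y (r m) s - Y (r m) t) /\<^sub>R (s - t)) \<longlonglongrightarrow> (y s - y t) /\<^sub>R (s - t)"
            using glim[of s] glim[of t] yg[of s] yg[of t] s t by (auto intro!: tendsto_intros)
          have "\<forall>\<^sub>F m in sequentially. norm (Y (r m) t - y t) < d / 3"
            using tendstoD[OF glim[of t], of "d / 3"] d yg[of t] t by (simp add: dist_norm)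
          moreover have "\<forall>\<^sub>F m in sequentially. M * ?e (r m) < d / 3"
            using order_tendstoD(2)[OF elimr, of "d / 3"] d by simp
          ultimately show "\<forall>\<^sub>F m in sequentially.
              (Y (r m) s - Y (r m) t) /\<^sub>R (s - t) \<in> {z. infdist z C \<le> e}"
          proof eventually_elim
            case (elim m)
            have "(Y (r m) s - Y (r m) t) /\<^sub>R (s - t) \<in> V"
            proof (rule YV)
              show "\<forall>z. norm (z - Y (r m) t) \<le> M * (s - t + ?e (r m)) \<longrightarrow> F z \<subseteq> V"
              proof (intro allI impI)
                fix z assume "norm (z - Y (r m) t) \<le> M * (s - t + ?e (r m))"
                then have "norm (z - Y (r m) t) \<le> M * (s - t) + M * ?e (r m)"
                  by (simp add: distrib_left)
                moreover have "norm (z - y t) \<le> norm (z - Y (r m) t) + norm (Y (r m) t - y t)"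
                  using norm_triangle_ineq[of "z - Y (r m) t" "Y (r m) t - y t"] by simp
                ultimately have "norm (z - y t) < d" using elim s(3) by linarith
                then have "z \<in> U" using d by (auto simp: dist_norm norm_minus_commute)
                then show "F z \<subseteq> V" using U by blast
              qed
            qed (use s t \<open>convex V\<close> in auto)
            then show ?case using Vinf by blast
          qed
        qed
        \<comment> \<open>The limit is taken from the right because \<open>YV\<close> controls
          forward quotients.\<close>
        have lim: "((\<lambda>s. (y s - y t) /\<^sub>R (s - t)) \<longlongrightarrow> v) (at_right t)"
        proof -
          have "(y has_derivative (\<lambda>h. h *\<^sub>R v)) (at_right t)"
            using has_vector_derivative_at_within[OF der] by (simp add: has_vector_derivative_def)
          then have "((\<lambda>s. ((y s - y t) - (s - t) *\<^sub>R v) /\<^sub>R norm (s - t)) \<longlongrightarrow> 0) (at_right t)"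
            by (simp add: has_derivative_at_within)
          from tendsto_add[OF this tendsto_const[of v]]
          have "((\<lambda>s. ((y s - y t) - (s - t) *\<^sub>R v) /\<^sub>R norm (s - t) + v) \<longlongrightarrow> v) (at_right t)"
            by simp
          then show ?thesis
            by (rule Lim_transform_eventually)
               (auto simp: eventually_at_right_field scaleR_diff_right intro!: exI[of _ "t + 1"])
        qed
        have "\<forall>\<^sub>F s in at_right t. (y s - y t) /\<^sub>R (s - t) \<in> {z. infdist z C \<le> e}"
        proof -
          define b where "b = min T (t + d / (3 * M))"
          have "t < b" using t d M by (simp add: b_def)
          moreover have "M * (s - t) < d / 3" if "s < b" for s
            using that M by (simp add: b_def field_simps)
          ultimately show ?thesis
            using quot by (auto simp: eventually_at_right_field b_def intro!: exI[of _ b])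
        qed
        from Lim_in_closed_set[OF clo this _ lim] show ?thesis by simp
      qed
      then have "infdist v C \<le> 0" by (rule field_le_epsilon[of _ 0, unfolded add_0])
      then show ?thesis
        using in_closed_iff_infdist_zero[OF C(1,2), of v] infdist_nonneg[of v C] by (simp add: C_def)
    qed
  qed
qed

subsection \<open>Descent of the potential\<close>

lemma lipschitz_abs_continuous_curve:
  assumes "M-lipschitz_on UNIV x"
  shows "abs_continuous_curve x"
  unfolding abs_continuous_curve_def
proof (intro allI impI)
  fix e :: real assume e: "0 < e"
  have M: "0 \<le> M" using assms lipschitz_on_nonneg by blast
  show "\<exists>\<delta>>0. \<forall>(N::nat) a b. (\<forall>i<N. 0 \<le> a i \<and> a i \<le> b i \<and> b i \<le> 1) \<and>
      disjoint_family_on (\<lambda>i. {a i<..<b i}) {..<N} \<and> (\<Sum>i<N. b i - a i) < \<delta>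
      \<longrightarrow> (\<Sum>i<N. norm (x (b i) - x (a i))) < e"
  proof (intro exI[of _ "e / (M + 1)"] conjI allI impI)
    show "0 < e / (M + 1)" using e M by simp
    fix N :: nat and a b :: "nat \<Rightarrow> real"
    assume ab: "(\<forall>i<N. 0 \<le> a i \<and> a i \<le> b i \<and> b i \<le> 1) \<and>
      disjoint_family_on (\<lambda>i. {a i<..<b i}) {..<N} \<and> (\<Sum>i<N. b i - a i) < e / (M + 1)"
    have "(\<Sum>i<N. norm (x (b i) - x (a i))) \<le> (\<Sum>i<N. (M + 1) * (b i - a i))"
    proof (rule sum_mono)
      fix i assume "i \<in> {..<N}"
      then have "a i \<le> b i" using ab by auto
      have "norm (x (b i) - x (a i)) \<le> M * (b i - a i)"
        using lipschitz_onD[OF assms, of "b i" "a i"] \<open>a i \<le> b i\<close> by (simp add: dist_norm)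
      also have "\<dots> \<le> (M + 1) * (b i - a i)" using \<open>a i \<le> b i\<close> by (intro mult_right_mono) auto
      finally show "norm (x (b i) - x (a i)) \<le> (M + 1) * (b i - a i)" .
    qed
    also have "\<dots> = (M + 1) * (\<Sum>i<N. b i - a i)" by (simp add: sum_distrib_left)
    also have "\<dots> < (M + 1) * (e / (M + 1))" using ab M by (intro mult_strict_left_mono) auto
    also have "\<dots> = e" using M by simp
    finally show "(\<Sum>i<N. norm (x (b i) - x (a i))) < e" .
  qed
qed

lemma locally_lipschitz_continuous_on:
  assumes "locally_lipschitz f"
  shows "continuous_on UNIV f"
proof (rule continuous_at_imp_continuous_on, rule ballI)
  fix x
  obtain r L where "r > 0" "L-lipschitz_on (ball x r) f"
    using assms unfolding locally_lipschitz_def by blast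
  then show "isCont f x"
    using lipschitz_on_continuous_on[of L "ball x r" f] continuous_on_interior[of "ball x r" f x]
    by (simp add: interior_open)
qed

lemma locally_lipschitz_compact:
  assumes "locally_lipschitz f" "compact Z"
  obtains L where "L-lipschitz_on Z f"
proof -
  \<comment> \<open>The map is made formally time-dependent over the single time 0, so that
    compactness yields one constant.\<close>
  have "local_lipschitz {0::real} Z (\<lambda>_. f)"
  proof (rule local_lipschitzI)
    fix t :: real and x assume "x \<in> Z"
    obtain r L where "r > 0" "L-lipschitz_on (ball x r) f"
      using assms unfolding locally_lipschitz_def by blast
    then have "L-lipschitz_on (cball x (r / 2) \<inter> Z) f"
      by (auto intro: lipschitz_on_subset)
    then show "\<exists>u>0. \<exists>L. \<forall>t\<in>cball t u \<inter> {0}. L-lipschitz_on (cball x u \<inter> Z) f"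
      using \<open>r > 0\<close> by (intro exI[of _ "r / 2"]) auto
  qed
  from local_lipschitz_compact_implies_lipschitz[OF this assms(2), of thesis] that
  show thesis by auto
qed

text \<open>On the compact set \<open>D\<close>, which avoids 0, \<open>\<kappa>\<close> attains a
  positive minimum, so the max-min value is negative and dominates the value at \<open>v\<close>.
  The Cauchy-Schwarz bound provides the boundedness under which real \<open>INF\<close> and
  \<open>SUP\<close> behave as infimum and supremum.\<close>

lemma max_min_inner_neg:
  fixes D :: "'a::euclidean_space set"
  assumes C: "compact C" "v \<in> C" and D: "compact D" "D \<noteq> {}" "0 \<notin> D"
    and \<kappa>: "\<kappa> \<in> class_P"
    and le: "(SUP u\<in>C. INF v\<in>D. u \<bullet> v) \<le> - (INF w\<in>D. \<kappa> w)"
  shows "(INF w\<in>D. v \<bullet> w) < 0"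
proof -
  have "continuous_on D \<kappa>" using \<kappa> continuous_on_subset unfolding class_P_def by blast
  then obtain w0 where w0: "w0 \<in> D" "\<And>w. w \<in> D \<Longrightarrow> \<kappa> w0 \<le> \<kappa> w"
    using continuous_attains_inf[OF D(1,2)] by blast
  have "0 < \<kappa> w0" using \<kappa> w0(1) D(3) unfolding class_P_def by (cases "w0 = 0") auto
  also have "\<kappa> w0 \<le> (INF w\<in>D. \<kappa> w)" by (rule cINF_greatest[OF D(2)]) (use w0 in blast)
  finally have neg: "(SUP u\<in>C. INF v\<in>D. u \<bullet> v) < 0" using le by simp
  obtain B where B: "\<And>w. w \<in> D \<Longrightarrow> norm w \<le> B"
    using compact_imp_bounded[OF D(1)] bounded_iff by blast
  obtain A where A: "\<And>u. u \<in> C \<Longrightarrow> norm u \<le> A"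
    using compact_imp_bounded[OF C(1)] bounded_iff by blast
  obtain w1 where w1: "w1 \<in> D" using D by blast
  have bnd: "\<bar>u \<bullet> w\<bar> \<le> A * B" if "u \<in> C" "w \<in> D" for u w
    using Cauchy_Schwarz_ineq2[of u w] mult_mono[OF A[OF that(1)] B[OF that(2)]] A[OF that(1)]
    by (smt (verit) norm_ge_zero)
  have "(INF w\<in>D. u \<bullet> w) \<le> A * B" if "u \<in> C" for u
  proof -
    have "(INF w\<in>D. u \<bullet> w) \<le> u \<bullet> w1"
    proof (rule cINF_lower[OF _ w1])
      show "bdd_below ((\<bullet>) u ` D)"
        by (rule bdd_belowI[of _ "- (A * B)"]) (use bnd[OF that] in force)
    qed
    also have "\<dots> \<le> A * B" using bnd[OF that w1] by simp
    finally show ?thesis .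
  qed
  then have "bdd_above ((\<lambda>u. INF w\<in>D. u \<bullet> w) ` C)" by (intro bdd_aboveI[of _ "A * B"]) auto
  then have "(INF w\<in>D. v \<bullet> w) \<le> (SUP u\<in>C. INF v\<in>D. u \<bullet> v)" by (rule cSUP_upper[OF C(2)])
  then show ?thesis using neg by simp
qed

text \<open>At almost every time the chain rule holds for all elements of \<open>D (y t)\<close> at
  once. Their inner products with the velocity therefore coincide, and the minimum over
  \<open>D (y t)\<close> is the derivative of \<open>f \<circ> y\<close>, negative by the descent
  inequality. The bound \<open>T \<le> 1\<close> keeps the times inside (0,1), where the chain rule
  is stated.\<close>

lemma solution_decreases:
  fixes F D :: "'a::euclidean_space \<Rightarrow> 'a set" and f :: "'a \<Rightarrow> real"
  assumes val: "\<And>x. compact (F x)"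
    and potential: "conservative_field f D"
    and descent: "\<And>z. \<exists>\<kappa>\<in>class_P. (SUP u\<in>convex hull F z. INF v\<in>D z. u \<bullet> v) \<le> - (INF w\<in>D z. \<kappa> w)"
    and Z: "compact Z" "\<And>z. z \<in> Z \<Longrightarrow> 0 \<notin> D z"
    and T: "0 < T" "T \<le> 1"
    and y: "M-lipschitz_on UNIV y" "\<And>s. y s \<in> Z"
    and sol: "\<And>t v. \<lbrakk>0 < t; t < T; (y has_vector_derivative v) (at t)\<rbrakk> \<Longrightarrow> v \<in> convex hull F (y t)"
  shows "f (y T) < f (y 0)"
proof -
  have ll: "locally_lipschitz f" and Dval: "\<And>x. D x \<noteq> {}" "\<And>x. compact (D x)"
    and chain: "\<And>x. abs_continuous_curve x \<Longrightarrow> AE t in lebesgue. t \<in> {0<..<1} \<longrightarrow>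
           (\<exists>x'. (x has_vector_derivative x') (at t) \<and>
                 (\<forall>v\<in>D (x t). ((f \<circ> x) has_real_derivative (v \<bullet> x')) (at t)))"
    using potential unfolding conservative_field_def by blast+
  obtain L where L: "L-lipschitz_on Z f" using locally_lipschitz_compact[OF ll Z(1)] .
  have "(L * M)-lipschitz_on UNIV (f \<circ> y)"
    by (rule lipschitz_on_compose[OF y(1) lipschitz_on_subset[OF L]]) (use y(2) in auto)
  then have "(L * M)-lipschitz_on {0..T} (f \<circ> y)" by (rule lipschitz_on_subset) simp
  moreover have "AE t in lebesgue. t \<in> {0<..<T} \<longrightarrow>
      (\<exists>d<0. ((f \<circ> y) has_real_derivative d) (at t))"
  proof (rule AE_mp[OF chain[OF lipschitz_abs_continuous_curve[OF y(1)]]], rule AE_I2, intro impI)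
    fix t assume ch: "t \<in> {0<..<1} \<longrightarrow> (\<exists>x'. (y has_vector_derivative x') (at t) \<and>
                 (\<forall>v\<in>D (y t). ((f \<circ> y) has_real_derivative (v \<bullet> x')) (at t)))"
      and t: "t \<in> {0<..<T}"
    then obtain x' where x': "(y has_vector_derivative x') (at t)"
      "\<And>v. v \<in> D (y t) \<Longrightarrow> ((f \<circ> y) has_real_derivative (v \<bullet> x')) (at t)"
      using T by force
    have hull: "x' \<in> convex hull F (y t)" using sol[OF _ _ x'(1)] t by simp
    obtain \<kappa> where "\<kappa> \<in> class_P"
      "(SUP u\<in>convex hull F (y t). INF v\<in>D (y t). u \<bullet> v) \<le> - (INF w\<in>D (y t). \<kappa> w)"
      using descent by blast
    from max_min_inner_neg[OF compact_convex_hull[OF val] hull Dval(2,1) Z(2)[OF y(2)] this]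
    have neg: "(INF w\<in>D (y t). x' \<bullet> w) < 0" .
    obtain v where v: "v \<in> D (y t)" using Dval(1) by blast
    have "x' \<bullet> w = x' \<bullet> v" if "w \<in> D (y t)" for w
      using DERIV_unique[OF x'(2)[OF that] x'(2)[OF v]] by (simp add: inner_commute)
    then have "(INF w\<in>D (y t). x' \<bullet> w) = (INF w\<in>D (y t). x' \<bullet> v)" by (intro INF_cong) auto
    then have "(INF w\<in>D (y t). x' \<bullet> w) = x' \<bullet> v" using Dval(1) by simp
    then show "\<exists>d<0. ((f \<circ> y) has_real_derivative d) (at t)"
      using neg x'(2)[OF v] by (auto simp: inner_commute)
  qed
  ultimately show ?thesis using lipschitz_ae_neg_deriv_imp_less[of "L * M" 0 T "f \<circ> y"] T(1) by simp
qed

text \<open>Only the first \<open>k\<close> steps are constrained, since the compactness argument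
  and the time windows concern finite stretches.\<close>

definition euler_arc ::
    "('a::euclidean_space \<Rightarrow> 'a set) \<Rightarrow> real \<Rightarrow> (nat \<Rightarrow> real) \<Rightarrow> (nat \<Rightarrow> 'a) \<Rightarrow> nat \<Rightarrow> bool" where
  "euler_arc F e \<alpha> x k \<longleftrightarrow>
     (\<forall>i<k. 0 < \<alpha> i \<and> \<alpha> i \<le> e \<and> (\<exists>u\<in>F (x i). x (Suc i) = x i + \<alpha> i *\<^sub>R u))"

text \<open>Otherwise the polygons through counterexamples with vanishing steps would converge to a
  solution of the differential inclusion along which \<open>f\<close> does not decrease.\<close>
lemma euler_uniform_descent:
  fixes F D :: "'a::euclidean_space \<Rightarrow> 'a set" and f :: "'a \<Rightarrow> real"
  assumes usc: "upper_semicontinuous F" and val: "\<And>x. F x \<noteq> {} \<and> compact (F x)"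
    and potential: "conservative_field f D"
    and descent: "\<And>z. \<exists>\<kappa>\<in>class_P. (SUP u\<in>convex hull F z. INF v\<in>D z. u \<bullet> v) \<le> - (INF w\<in>D z. \<kappa> w)"
    and Z: "compact Z" "\<And>z. z \<in> Z \<Longrightarrow> 0 \<notin> D z"
    and T: "0 < T" "T \<le> 1"
  shows "\<exists>e>0. \<forall>\<alpha> x k. euler_arc F e \<alpha> x k \<and>
      (\<forall>i\<le>k. x i \<in> Z) \<and> T \<le> (\<Sum>i<k. \<alpha> i) \<and> (\<Sum>i<k. \<alpha> i) \<le> T + e
    \<longrightarrow> f (x k) \<le> f (x 0) - e"
proof (rule ccontr)
  assume neg: "\<not> ?thesis"
  \<comment> \<open>A single tolerance \<open>1 / Suc m\<close> bounds the steps, the overshoot in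
    time and the drop of \<open>f\<close> that is not reached.\<close>
  have "\<exists>\<alpha> x k. (\<forall>i<k. 0 < \<alpha> i \<and> \<alpha> i \<le> 1 / Suc m \<and> (\<exists>u\<in>F (x i). x (Suc i) = x i + \<alpha> i *\<^sub>R u)) \<and>
      (\<forall>i\<le>k. x i \<in> Z) \<and> T \<le> (\<Sum>i<k. \<alpha> i) \<and> (\<Sum>i<k. \<alpha> i) \<le> T + 1 / Suc m \<and>
      f (x 0) - 1 / Suc m < f (x k)" for m
    using neg[unfolded not_ex euler_arc_def, rule_format, of "1 / Suc m"] by (simp add: not_le)
  then obtain \<alpha> x k where
    *: "\<And>m. (\<forall>i<k m. 0 < \<alpha> m i \<and> \<alpha> m i \<le> 1 / Suc m \<and>
          (\<exists>u\<in>F (x m i). x m (Suc i) = x m i + \<alpha> m i *\<^sub>R u)) \<and>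
      (\<forall>i\<le>k m. x m i \<in> Z) \<and> T \<le> (\<Sum>i<k m. \<alpha> m i) \<and> (\<Sum>i<k m. \<alpha> m i) \<le> T + 1 / Suc m \<and>
      f (x m 0) - 1 / Suc m < f (x m (k m))" by metis
  obtain y M r where r: "strict_mono (r :: nat \<Rightarrow> nat)" and y: "M-lipschitz_on UNIV y" "\<And>s. y s \<in> Z"
    and lim: "(\<lambda>m. x (r m) 0) \<longlonglongrightarrow> y 0" "(\<lambda>m. x (r m) (k (r m))) \<longlonglongrightarrow> y T"
    and sol: "\<And>t v. \<lbrakk>0 < t; t < T; (y has_vector_derivative v) (at t)\<rbrakk> \<Longrightarrow> v \<in> convex hull F (y t)"
  proof (rule euler_limit[of F Z T k \<alpha> x])
    show "0 < \<alpha> m i \<and> \<alpha> m i \<le> 1 / Suc m" "\<exists>u\<in>F (x m i). x m (Suc i) = x m i + \<alpha> m i *\<^sub>R u"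
      if "i < k m" for m i using *[of m] that by blast+
    show "x m i \<in> Z" if "i \<le> k m" for m i using *[of m] that by blast
    show "T \<le> (\<Sum>i<k m. \<alpha> m i)" "(\<Sum>i<k m. \<alpha> m i) \<le> T + 1 / Suc m" for m using *[of m] by blast+
  qed (use usc val Z T in auto)
  have "f (y T) < f (y 0)"
    by (rule solution_decreases[OF _ potential descent Z T y sol]) (use val in auto)
  moreover have "f (y 0) \<le> f (y T)"
  proof -
    have cont: "isCont f z" for z
      using locally_lipschitz_continuous_on[of f] potential
      by (simp add: conservative_field_def continuous_on_eq_continuous_at)
    have "(\<lambda>m. 1 / real (Suc (r m))) \<longlonglongrightarrow> 0"
      using LIMSEQ_subseq_LIMSEQ[OF LIMSEQ_Suc[OF lim_1_over_n] r] by (simp add: o_def)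
    from tendsto_diff[OF isCont_tendsto_compose[OF cont lim(1)] this]
    have "(\<lambda>m. f (x (r m) 0) - 1 / real (Suc (r m))) \<longlonglongrightarrow> f (y 0)" by simp
    moreover have "f (x (r m) 0) - 1 / real (Suc (r m)) \<le> f (x (r m) (k (r m)))" for m
      using * less_imp_le by blast
    ultimately show ?thesis
      using isCont_tendsto_compose[OF cont lim(2)] LIMSEQ_le by blast
  qed
  ultimately show False by simp
qed

subsection \<open>Stability of the common sublevel sets\<close>

lemma backward_window:
  fixes \<alpha> :: "nat \<Rightarrow> real"
  assumes \<alpha>: "\<And>i. \<alpha> i \<le> e" and T: "0 < T" "T \<le> (\<Sum>i<k. \<alpha> i)"
  obtains j where "j < k" "T \<le> (\<Sum>i=j..<k. \<alpha> i)" "(\<Sum>i=j..<k. \<alpha> i) \<le> T + e"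
proof -
  \<comment> \<open>The largest admissible start index is taken: removing its step leaves less than
    \<open>T\<close>, so the overshoot is at most one step.\<close>
  define J where "J = {j. j \<le> k \<and> T \<le> (\<Sum>i=j..<k. \<alpha> i)}"
  have fin: "finite J" by (simp add: J_def)
  have "0 \<in> J" using T by (simp add: J_def lessThan_atLeast0)
  then have J: "Max J \<in> J" using Max_in[OF fin] by blast
  then have lt: "Max J < k" using T by (cases "Max J = k") (auto simp: J_def)
  have "Suc (Max J) \<notin> J" using Max_ge[OF fin, of "Suc (Max J)"] by auto
  then have "(\<Sum>i=Suc (Max J)..<k. \<alpha> i) < T" using lt by (auto simp: J_def)
  then show thesis
    using that[OF lt] J \<alpha>[of "Max J"] sum.atLeast_Suc_lessThan[OF lt, of \<alpha>] by (auto simp: J_def)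
qed

lemma forward_window:
  fixes \<alpha> :: "nat \<Rightarrow> real"
  assumes \<alpha>: "\<And>i. j \<le> i \<Longrightarrow> \<alpha> i \<le> e" and T: "0 < T" "T \<le> (\<Sum>i=j..<m. \<alpha> i)"
  obtains k where "j < k" "T \<le> (\<Sum>i=j..<k. \<alpha> i)" "(\<Sum>i=j..<k. \<alpha> i) \<le> T + e"
proof -
  define k where "k = (LEAST k. T \<le> (\<Sum>i=j..<k. \<alpha> i))"
  have k: "T \<le> (\<Sum>i=j..<k. \<alpha> i)" unfolding k_def by (rule LeastI[of "\<lambda>k. T \<le> (\<Sum>i=j..<k. \<alpha> i)", OF T(2)])
  then have jk: "j < k" using T(1) by (cases "j < k") auto
  then obtain k' where k': "k = Suc k'" "j \<le> k'" by (cases k) auto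
  then have "(\<Sum>i=j..<k'. \<alpha> i) < T"
    unfolding k_def by (metis lessI not_le not_less_Least)
  then show thesis using that[OF jk k] \<alpha>[OF k'(2)] k' by simp
qed

text \<open>A tail with bounded partial sums would be summable. Nothing forces
  \<open>j \<le> m\<close>; for smaller \<open>m\<close> the sum is empty, hence zero.\<close>

lemma not_summable_unbounded:
  fixes a :: "nat \<Rightarrow> real"
  assumes "\<And>i. 0 \<le> a i" "\<not> summable a"
  obtains m where "B \<le> (\<Sum>i=j..<m. a i)"
proof (rule ccontr)
  assume no: "\<not> thesis"
  have "(\<Sum>i<n. a (i + j)) \<le> B" for n
    using that[of "n + j"] no sum.shift_bounds_nat_ivl[of a 0 j n] by (force simp: lessThan_atLeast0)
  then have "summable (\<lambda>i. a (i + j))" using assms(1) by (intro summableI_nonneg_bounded[of _ B]) auto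
  then show False using assms(2) summable_iff_shift by blast
qed

text \<open>Counterexamples for \<open>s = 1 / Suc m\<close> accumulate at a point with
  \<open>f z \<le> 0\<close>, whose neighbourhood has an admissible constant that
  \<open>anti\<close> transfers to all smaller ones. Letting \<open>s\<close> be both the threshold
  for \<open>f\<close> and the parameter of \<open>P\<close> makes one number enough.\<close>

lemma compact_near_zero_set:
  fixes K :: "'a::metric_space set" and f :: "'a \<Rightarrow> real"
  assumes "compact K" "continuous_on K f"
    and loc: "\<And>z. z \<in> K \<Longrightarrow> f z \<le> 0 \<Longrightarrow> \<exists>W s. open W \<and> z \<in> W \<and> 0 < s \<and> (\<forall>x\<in>W. P x s)"
    and anti: "\<And>x s s'. P x s \<Longrightarrow> 0 < s' \<Longrightarrow> s' \<le> s \<Longrightarrow> P x s'"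
  obtains s :: real where "0 < s" "\<And>x. x \<in> K \<Longrightarrow> f x \<le> s \<Longrightarrow> P x s"
proof (rule ccontr)
  assume no: "\<not> thesis"
  have "\<exists>x\<in>K. f x \<le> 1 / Suc m \<and> \<not> P x (1 / Suc m)" for m
    using that[of "1 / Suc m"] no by force
  then obtain x where x: "\<And>m. x m \<in> K" "\<And>m. f (x m) \<le> 1 / Suc m" "\<And>m. \<not> P (x m) (1 / Suc m)"
    by metis
  obtain z r where z: "z \<in> K" "strict_mono (r :: nat \<Rightarrow> nat)" "(x \<circ> r) \<longlonglongrightarrow> z"
    using assms(1) x(1) unfolding compact_def by metis
  have lim0: "(\<lambda>m. 1 / real (Suc (r m))) \<longlonglongrightarrow> 0"
    using LIMSEQ_subseq_LIMSEQ[OF LIMSEQ_Suc[OF lim_1_over_n] z(2)] by (simp add: o_def)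
  have "(\<lambda>m. f (x (r m))) \<longlonglongrightarrow> f z"
    using continuous_on_tendsto_compose[OF assms(2) z(3)] z(1) x(1) by (simp add: o_def)
  then have "f z \<le> 0" using lim0 x(2) LIMSEQ_le by blast
  then obtain W s where W: "open W" "z \<in> W" "0 < s" "\<forall>x\<in>W. P x s" using loc[OF z(1)] by blast
  have "\<forall>\<^sub>F m in sequentially. x (r m) \<in> W"
    using topological_tendstoD[OF z(3) W(1,2)] by (simp add: o_def)
  moreover have "\<forall>\<^sub>F m in sequentially. 1 / real (Suc (r m)) < s"
    using order_tendstoD(2)[OF lim0 W(3)] .
  ultimately have "\<forall>\<^sub>F m in sequentially. False"
  proof eventually_elim
    case (elim m)
    then have "P (x (r m)) (1 / Suc (r m))" using W(4) anti[of "x (r m)" s "1 / Suc (r m)"] by auto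
    then show False using x(3) by blast
  qed
  then show False by simp
qed

lemma euler_sequence_shift: "euler_sequence F \<alpha> x \<Longrightarrow> euler_sequence F (\<lambda>i. \<alpha> (j + i)) (\<lambda>i. x (j + i))"
  by (auto simp: euler_sequence_def)

text \<open>Continuous time and the conservative field enter the discrete argument only through the
  axiom \<open>descent\<close>; everything else is compactness of \<open>N\<close> and the speed
  bound \<open>M\<close>.\<close>

locale euler_descent =
  fixes F :: "'a::euclidean_space \<Rightarrow> 'a set" and f :: "'a \<Rightarrow> real" and N :: "'a set" and M :: real
  assumes compact_N: "compact N" and continuous_f: "continuous_on N f"
    and f_nonneg: "\<And>x. x \<in> N \<Longrightarrow> 0 \<le> f x"
    and speed: "0 < M" "\<And>x u. x \<in> N \<Longrightarrow> u \<in> F x \<Longrightarrow> norm u \<le> M"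
    and descent: "\<And>a T. 0 < a \<Longrightarrow> 0 < T \<Longrightarrow> T \<le> 1 \<Longrightarrow>
      \<exists>e>0. \<forall>\<alpha> x k. euler_arc F e \<alpha> x k \<and> (\<forall>i\<le>k. x i \<in> {x \<in> N. a \<le> f x}) \<and>
        T \<le> (\<Sum>i<k. \<alpha> i) \<and> (\<Sum>i<k. \<alpha> i) \<le> T + e \<longrightarrow> f (x k) \<le> f (x 0) - e"
begin

lemma descent_window:
  assumes "0 < a" "0 < T" "T \<le> 1"
  obtains e where "0 < e"
    "\<And>\<alpha> x j k. \<lbrakk>euler_sequence F \<alpha> x; j \<le> k; \<And>i. j \<le> i \<Longrightarrow> i < k \<Longrightarrow> 0 < \<alpha> i \<and> \<alpha> i \<le> e;
      \<And>i. j \<le> i \<Longrightarrow> i \<le> k \<Longrightarrow> x i \<in> N \<and> a \<le> f (x i);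
      T \<le> (\<Sum>i=j..<k. \<alpha> i); (\<Sum>i=j..<k. \<alpha> i) \<le> T + e\<rbrakk> \<Longrightarrow> f (x k) \<le> f (x j) - e"
proof -
  obtain e where e: "0 < e" "\<And>\<alpha> x k. euler_arc F e \<alpha> x k \<Longrightarrow> (\<forall>i\<le>k. x i \<in> {x \<in> N. a \<le> f x}) \<Longrightarrow>
        T \<le> (\<Sum>i<k. \<alpha> i) \<Longrightarrow> (\<Sum>i<k. \<alpha> i) \<le> T + e \<Longrightarrow> f (x k) \<le> f (x 0) - e"
    using descent[OF assms] by blast
  show thesis
  proof (rule that[OF e(1)])
    fix \<alpha> x and j k :: nat
    assume *: "euler_sequence F \<alpha> x" "j \<le> k" "\<And>i. j \<le> i \<Longrightarrow> i < k \<Longrightarrow> 0 < \<alpha> i \<and> \<alpha> i \<le> e"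
      "\<And>i. j \<le> i \<Longrightarrow> i \<le> k \<Longrightarrow> x i \<in> N \<and> a \<le> f (x i)"
      "T \<le> (\<Sum>i=j..<k. \<alpha> i)" "(\<Sum>i=j..<k. \<alpha> i) \<le> T + e"
    have s: "(\<Sum>i<k - j. \<alpha> (j + i)) = (\<Sum>i=j..<k. \<alpha> i)"
      by (simp add: sum.atLeastLessThan_shift_0[of \<alpha> j k] lessThan_atLeast0)
    have "f (x (j + (k - j))) \<le> f (x (j + 0)) - e"
      by (rule e(2)[of "\<lambda>i. \<alpha> (j + i)" "\<lambda>i. x (j + i)" "k - j"])
         (use * s in \<open>auto simp: euler_arc_def euler_sequence_def\<close>)
    then show "f (x k) \<le> f (x j) - e" using *(2) by simp
  qed
qed

lemma step_norm:
  assumes "euler_sequence F \<alpha> x" "0 < \<alpha> i" "x i \<in> N"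
  shows "norm (x (Suc i) - x i) \<le> M * \<alpha> i"
proof -
  obtain u where "u \<in> F (x i)" "x (Suc i) = x i + \<alpha> i *\<^sub>R u"
    using assms(1) unfolding euler_sequence_def by blast
  then show ?thesis using speed(2)[OF assms(3)] assms(2) by (simp add: mult.commute)
qed

lemma displacement:
  assumes "euler_sequence F \<alpha> x" "\<And>i. 0 < \<alpha> i" "j \<le> k" "\<And>i. j \<le> i \<Longrightarrow> i < k \<Longrightarrow> x i \<in> N"
  shows "norm (x k - x j) \<le> M * (\<Sum>i=j..<k. \<alpha> i)"
  using assms(3,4)
proof (induction k rule: dec_induct)
  case (step k)
  have "norm (x (Suc k) - x j) \<le> norm (x (Suc k) - x k) + norm (x k - x j)"
    using norm_triangle_ineq[of "x (Suc k) - x k" "x k - x j"] by simp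
  also have "\<dots> \<le> M * \<alpha> k + M * (\<Sum>i=j..<k. \<alpha> i)"
    by (intro add_mono step_norm[OF assms(1,2)] step.IH) (use step in auto)
  finally show ?case using step by (simp add: distrib_left add.commute)
qed simp

lemma uniform:
  assumes "continuous_on N h" "0 < (c::real)"
  obtains d where "0 < d" "\<And>x y. x \<in> N \<Longrightarrow> y \<in> N \<Longrightarrow> norm (x - y) < d \<Longrightarrow> \<bar>h x - h y :: real\<bar> < c"
  using compact_uniformly_continuous[OF assms(1) compact_N] assms(2)
  unfolding uniformly_continuous_on_def dist_norm real_norm_def by metis

text \<open>A first exceedance of \<open>\<mu>\<close> would be preceded by a stretch of positive length spent in
  \<open>{\<mu>/2 \<le> f \<le> \<mu>}\<close>, over which \<open>f\<close> decreases by a definite amount.\<close>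
lemma barrier:
  assumes "0 < \<mu>"
  obtains e where "0 < e" "\<And>\<alpha> x k. \<lbrakk>euler_sequence F \<alpha> x; \<And>i. 0 < \<alpha> i \<and> \<alpha> i \<le> e;
      \<And>i. i \<le> k \<Longrightarrow> x i \<in> N; f (x 0) \<le> \<mu> / 2\<rbrakk> \<Longrightarrow> f (x k) \<le> \<mu>"
proof -
  obtain d where d: "0 < d" "\<And>x y. x \<in> N \<Longrightarrow> y \<in> N \<Longrightarrow> norm (x - y) < d \<Longrightarrow> \<bar>f x - f y\<bar> < \<mu> / 2"
    using uniform[OF continuous_f, of "\<mu> / 2"] assms by auto
  \<comment> \<open>The time is so short that the distance \<open>M * (T + e)\<close> travelled
    stays below \<open>d\<close>, over which \<open>f\<close> changes by less than
    \<open>\<mu> / 2\<close>.\<close>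
  define T where "T = min 1 (d / (2 * M))"
  have T: "0 < T" "T \<le> 1" using d speed by (auto simp: T_def)
  have MT: "M * T \<le> d / 2" using speed by (simp add: T_def min_def field_simps)
  obtain e0 where e0: "0 < e0"
    "\<And>\<alpha> x j k. \<lbrakk>euler_sequence F \<alpha> x; j \<le> k; \<And>i. j \<le> i \<Longrightarrow> i < k \<Longrightarrow> 0 < \<alpha> i \<and> \<alpha> i \<le> e0;
      \<And>i. j \<le> i \<Longrightarrow> i \<le> k \<Longrightarrow> x i \<in> N \<and> \<mu> / 2 \<le> f (x i);
      T \<le> (\<Sum>i=j..<k. \<alpha> i); (\<Sum>i=j..<k. \<alpha> i) \<le> T + e0\<rbrakk> \<Longrightarrow> f (x k) \<le> f (x j) - e0"
    using descent_window[of "\<mu> / 2" T] assms T by auto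
  define e where "e = min e0 (d / (4 * M))"
  have e: "0 < e" "e \<le> e0" using e0 d speed by (auto simp: e_def)
  have "M * e \<le> d / 4" using speed by (simp add: e_def min_def field_simps)
  with MT have MTe: "M * (T + e) < d" using d by (simp add: distrib_left)
  show thesis
  proof (rule that[OF e(1)], rule ccontr)
    fix \<alpha> x k
    assume eul: "euler_sequence F \<alpha> x" and \<alpha>: "\<And>i. 0 < \<alpha> i \<and> \<alpha> i \<le> e"
      and xN: "\<And>i. i \<le> k \<Longrightarrow> x i \<in> N" and x0: "f (x 0) \<le> \<mu> / 2" and "\<not> f (x k) \<le> \<mu>"
    \<comment> \<open>The first exceedance of \<open>\<mu>\<close>. Looking back from it over a
      window of length about \<open>T\<close>, \<open>f\<close> stays above
      \<open>\<mu> / 2\<close>, so \<open>descent_window\<close> applies and contradicts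
      \<open>before\<close>.\<close>
    define n where "n = (LEAST n. \<mu> < f (x n))"
    have n: "\<mu> < f (x n)" "n \<le> k"
      using LeastI[of "\<lambda>n. \<mu> < f (x n)" k] Least_le[of "\<lambda>n. \<mu> < f (x n)" k] \<open>\<not> f (x k) \<le> \<mu>\<close>
      by (auto simp: n_def not_le)
    have before: "f (x i) \<le> \<mu>" if "i < n" for i
      using not_less_Least[of i "\<lambda>n. \<mu> < f (x n)"] that by (auto simp: n_def not_le)
    have close: "\<mu> / 2 < f (x i)" if "i \<le> n" "(\<Sum>i=i..<n. \<alpha> i) \<le> T + e" for i
    proof -
      have "norm (x n - x i) \<le> M * (\<Sum>i=i..<n. \<alpha> i)"
        by (rule displacement[OF eul]) (use \<alpha> that xN n in auto)
      also have "\<dots> \<le> M * (T + e)" using speed that by (intro mult_left_mono) auto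
      finally have "\<bar>f (x n) - f (x i)\<bar> < \<mu> / 2" using MTe that n by (intro d(2)[OF xN xN]) auto
      then show ?thesis using n(1) by linarith
    qed
    \<comment> \<open>Otherwise the window would reach back to index 0, where \<open>f\<close> is at
      most \<open>\<mu> / 2\<close>.\<close>
    have "T \<le> (\<Sum>i<n. \<alpha> i)"
      using close[of 0] x0 e(1) by (force simp: lessThan_atLeast0)
    then obtain j where j: "j < n" "T \<le> (\<Sum>i=j..<n. \<alpha> i)" "(\<Sum>i=j..<n. \<alpha> i) \<le> T + e"
      using backward_window[of \<alpha> e T n] \<alpha> T by blast
    have "f (x n) \<le> f (x j) - e0"
    proof (rule e0(2)[OF eul])
      show "0 < \<alpha> i \<and> \<alpha> i \<le> e0" for i using \<alpha>[of i] e by auto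
      show "x i \<in> N \<and> \<mu> / 2 \<le> f (x i)" if "j \<le> i" "i \<le> n" for i
      proof -
        have "(\<Sum>i=i..<n. \<alpha> i) \<le> (\<Sum>i=j..<n. \<alpha> i)"
          by (rule sum_mono2) (use that \<alpha> less_imp_le in auto)
        then show ?thesis using close[of i] that j xN n by auto
      qed
    qed (use j e in auto)
    then show False using before[OF j(1)] n(1) e0(1) by linarith
  qed
qed

text \<open>Infinite total time forces a late visit to \<open>{f \<le> \<mu>/2}\<close>, because
  every unit of time outside costs a fixed amount of a nonnegative function. From that visit on,
  \<open>barrier\<close> applied to the shifted sequence keeps \<open>f\<close> at most
  \<open>\<mu>\<close>.\<close>

lemma f_tendsto_0:
  assumes eul: "euler_sequence F \<alpha> x" and \<alpha>: "\<And>i. 0 < \<alpha> i" "\<alpha> \<longlonglongrightarrow> 0" "\<not> summable \<alpha>"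
    and xN: "\<And>i. x i \<in> N"
  shows "(\<lambda>k. f (x k)) \<longlonglongrightarrow> 0"
proof (rule LIMSEQ_I)
  fix c :: real assume "0 < c"
  define \<mu> where "\<mu> = c / 2"
  have \<mu>: "0 < \<mu>" using \<open>0 < c\<close> by (simp add: \<mu>_def)
  obtain e where e: "0 < e" "\<And>\<alpha> x k. \<lbrakk>euler_sequence F \<alpha> x; \<And>i. 0 < \<alpha> i \<and> \<alpha> i \<le> e;
      \<And>i. i \<le> k \<Longrightarrow> x i \<in> N; f (x 0) \<le> \<mu> / 2\<rbrakk> \<Longrightarrow> f (x k) \<le> \<mu>" using barrier[OF \<mu>] by metis
  obtain e' where e': "0 < e'"
    "\<And>\<alpha> x j k. \<lbrakk>euler_sequence F \<alpha> x; j \<le> k; \<And>i. j \<le> i \<Longrightarrow> i < k \<Longrightarrow> 0 < \<alpha> i \<and> \<alpha> i \<le> e';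
      \<And>i. j \<le> i \<Longrightarrow> i \<le> k \<Longrightarrow> x i \<in> N \<and> \<mu> / 2 \<le> f (x i);
      1 \<le> (\<Sum>i=j..<k. \<alpha> i); (\<Sum>i=j..<k. \<alpha> i) \<le> 1 + e'\<rbrakk> \<Longrightarrow> f (x k) \<le> f (x j) - e'"
    using descent_window[of "\<mu> / 2" 1] \<mu> by auto
  obtain K where K: "\<And>i. K \<le> i \<Longrightarrow> \<alpha> i \<le> min e e'"
    using order_tendstoD(2)[OF \<alpha>(2), of "min e e'"] e(1) e'(1) less_imp_le
    unfolding eventually_sequentially by (metis min_less_iff_conj)
  have "\<exists>k\<ge>K. f (x k) \<le> \<mu> / 2"
  proof (rule ccontr)
    assume "\<not> ?thesis"
    then have big: "\<mu> / 2 \<le> f (x k)" if "K \<le> k" for k using that by force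
    \<comment> \<open>Concatenates \<open>n\<close> windows of length about 1, each lowering
      \<open>f\<close> by at least \<open>e'\<close>.\<close>
    have "\<exists>k\<ge>K. f (x k) \<le> f (x K) - real n * e'" for n
    proof (induction n)
      case (Suc n)
      then obtain j where j: "K \<le> j" "f (x j) \<le> f (x K) - real n * e'" by blast
      obtain m where "1 \<le> (\<Sum>i=j..<m. \<alpha> i)" using not_summable_unbounded[of \<alpha>] \<alpha>(1,3) less_imp_le by metis
      then obtain k where k: "j < k" "1 \<le> (\<Sum>i=j..<k. \<alpha> i)" "(\<Sum>i=j..<k. \<alpha> i) \<le> 1 + e'"
        using forward_window[of j \<alpha> e' 1 m] K j(1) by force
      have "f (x k) \<le> f (x j) - e'"
        by (rule e'(2)[OF eul]) (use k j K \<alpha>(1) xN big in force)+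
      then have "f (x k) \<le> f (x K) - real (Suc n) * e'" using j by (simp add: algebra_simps)
      then show ?case using j k by (intro exI[of _ k]) auto
    qed auto
    moreover obtain n where "f (x K) < real n * e'" using reals_Archimedean3[OF e'(1)] by blast
    ultimately show False using f_nonneg[OF xN] by (smt (verit))
  qed
  then obtain k where k: "K \<le> k" "f (x k) \<le> \<mu> / 2" by blast
  have "f (x (k + i)) \<le> \<mu>" for i
    by (rule e(2)[OF euler_sequence_shift[OF eul], of k i]) (use k \<alpha>(1) K xN in auto)
  then have "f (x i) \<le> \<mu>" if "k \<le> i" for i using that by (metis le_add_diff_inverse)
  then have "norm (f (x i) - 0) < c" if "k \<le> i" for i
    using that f_nonneg[OF xN, of i] \<open>0 < c\<close> by (fastforce simp: \<mu>_def)
  then show "\<exists>no. \<forall>i\<ge>no. norm (f (x i) - 0) < c" by blast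
qed

section \<open>Common sublevel sets of the potential and \<open>G\<close> near
  \<open>X\<close>\<close>

lemma sublevel:
  assumes G: "continuous_on N G" and zero: "\<And>x. \<lbrakk>x \<in> N; f x = 0; G x \<le> 0\<rbrakk> \<Longrightarrow> x \<in> X" and "0 < \<epsilon>"
  obtains \<eta> :: real where "0 < \<eta>" "\<And>x. \<lbrakk>x \<in> N; f x \<le> \<eta>; G x \<le> \<eta>\<rbrakk> \<Longrightarrow> infdist x X < \<epsilon>"
\<comment> \<open>Points of \<open>N\<close> where the maximum is at most 0 lie in \<open>X\<close>.
  The predicate ignores its second argument; only the threshold matters here.\<close>
proof (rule compact_near_zero_set[OF compact_N, of "\<lambda>x. max (f x) (G x)" "\<lambda>x _. infdist x X < \<epsilon>"])
  show "continuous_on N (\<lambda>x. max (f x) (G x))" by (intro continuous_intros continuous_f G)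
  fix z assume z: "z \<in> N" "max (f z) (G z) \<le> 0"
  then have "z \<in> X" using zero f_nonneg by force
  then have "\<forall>x\<in>ball z \<epsilon>. infdist x X < \<epsilon>"
    using infdist_le2 by (metis infdist_le le_less_trans dist_commute mem_ball)
  then show "\<exists>W s. open W \<and> z \<in> W \<and> (0::real) < s \<and> (\<forall>x\<in>W. infdist x X < \<epsilon>)"
    using \<open>0 < \<epsilon>\<close> by (intro exI[of _ "ball z \<epsilon>"] exI[of _ 1]) auto
qed (use that in auto)

text \<open>A nearest point of \<open>X\<close> also lies in \<open>N\<close>, so uniform continuity
  on \<open>N\<close> compares the two values of \<open>f\<close> and of \<open>G\<close>.\<close>

lemma near_X:
  assumes X: "X \<noteq> {}" "0 < r" and N: "N = {x. infdist x X \<le> r}" and "closed X"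
    and G: "continuous_on N G" and on_X: "\<And>x. x \<in> X \<Longrightarrow> f x = 0 \<and> G x \<le> (0::real)" and "0 < c"
  obtains \<delta> where "0 < \<delta>" "\<And>x. infdist x X < \<delta> \<Longrightarrow> x \<in> N \<and> f x \<le> c \<and> G x \<le> c"
proof -
  obtain d where d: "0 < d" "\<And>x y. x \<in> N \<Longrightarrow> y \<in> N \<Longrightarrow> norm (x - y) < d \<Longrightarrow> \<bar>f x - f y\<bar> < c"
    using uniform[OF continuous_f \<open>0 < c\<close>] by metis
  obtain d' where d': "0 < d'" "\<And>x y. x \<in> N \<Longrightarrow> y \<in> N \<Longrightarrow> norm (x - y) < d' \<Longrightarrow> \<bar>G x - G y\<bar> < c"
    using uniform[OF G \<open>0 < c\<close>] by metis
  show thesis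
  proof (rule that[of "min r (min d d')"])
    show "0 < min r (min d d')" using X d d' by simp
    fix x assume x: "infdist x X < min r (min d d')"
    obtain y where y: "y \<in> X" "infdist x X = dist x y"
      using infdist_attains_inf[OF \<open>closed X\<close> X(1)] by metis
    then have xy: "x \<in> N" "y \<in> N" using x X by (auto simp: N)
    then show "x \<in> N \<and> f x \<le> c \<and> G x \<le> c"
      using d(2)[OF xy] d'(2)[OF xy] on_X[OF y(1)] x y(2) by (auto simp: dist_norm)
  qed
qed

text \<open>The one-step hypothesis on \<open>G\<close> is required only where \<open>f\<close> is small and \<open>G\<close> bounded
  away from zero; elsewhere \<open>f\<close> alone controls the iterates.\<close>
lemma d_stable_argmin:
  assumes X: "X \<noteq> {}" "0 < r" and N: "N = {x. infdist x X \<le> r}" and cl: "closed X"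
    and G: "continuous_on N G" and on_X: "\<And>x. x \<in> X \<Longrightarrow> f x = 0 \<and> G x \<le> 0"
    and zero: "\<And>x. \<lbrakk>x \<in> N; f x = 0; G x \<le> 0\<rbrakk> \<Longrightarrow> x \<in> X"
    and step: "\<And>\<eta>. 0 < \<eta> \<Longrightarrow> \<exists>s>0. \<forall>x\<in>N. f x \<le> s \<and> \<eta> \<le> G x \<longrightarrow>
       (\<forall>\<alpha> u. 0 < \<alpha> \<and> \<alpha> \<le> s \<and> u \<in> F x \<and> x + \<alpha> *\<^sub>R u \<in> N \<longrightarrow> G (x + \<alpha> *\<^sub>R u) \<le> (G x :: real))"
  shows "d_stable F X"
  unfolding d_stable_def
proof (intro allI impI)
  fix \<epsilon> :: real assume "0 < \<epsilon>"
  \<comment> \<open>The cap \<open>r\<close> keeps the tube inside \<open>N\<close>. Iterates will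
    be shown to stay within half of \<open>\<epsilon>'\<close>; the other half absorbs one step, so
    that the next iterate is known to be in \<open>N\<close> before \<open>f\<close> and
    \<open>G\<close> are estimated there.\<close>
  define \<epsilon>' where "\<epsilon>' = min \<epsilon> r"
  have \<epsilon>': "0 < \<epsilon>'" "\<epsilon>' \<le> \<epsilon>" "\<epsilon>' \<le> r" using \<open>0 < \<epsilon>\<close> X by (auto simp: \<epsilon>'_def)
  obtain \<eta> where \<eta>: "0 < \<eta>" "\<And>x. \<lbrakk>x \<in> N; f x \<le> \<eta>; G x \<le> \<eta>\<rbrakk> \<Longrightarrow> infdist x X < \<epsilon>' / 2"
    using sublevel[OF G zero, of "\<epsilon>' / 2"] \<epsilon>'(1) by auto
  obtain s where s: "0 < s" "\<And>x \<alpha> u. \<lbrakk>x \<in> N; f x \<le> s; \<eta> / 2 \<le> G x; 0 < \<alpha>; \<alpha> \<le> s; u \<in> F x;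
      x + \<alpha> *\<^sub>R u \<in> N\<rbrakk> \<Longrightarrow> G (x + \<alpha> *\<^sub>R u) \<le> G x"
    using step[of "\<eta> / 2"] \<eta>(1) by auto
  \<comment> \<open>Below \<open>\<mu>\<close> the potential is small enough both for
    \<open>sublevel\<close> and for the one-step hypothesis.\<close>
  define \<mu> where "\<mu> = min \<eta> s"
  have \<mu>: "0 < \<mu>" "\<mu> \<le> \<eta>" "\<mu> \<le> s" using \<eta> s by (auto simp: \<mu>_def)
  obtain e where e: "0 < e" "\<And>\<alpha> x k. \<lbrakk>euler_sequence F \<alpha> x; \<And>i. 0 < \<alpha> i \<and> \<alpha> i \<le> e;
      \<And>i. i \<le> k \<Longrightarrow> x i \<in> N; f (x 0) \<le> \<mu> / 2\<rbrakk> \<Longrightarrow> f (x k) \<le> \<mu>" using barrier[OF \<mu>(1)] by metis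
  obtain d where d: "0 < d" "\<And>x y. x \<in> N \<Longrightarrow> y \<in> N \<Longrightarrow> norm (x - y) < d \<Longrightarrow> \<bar>G x - G y\<bar> < \<eta> / 2"
    using uniform[OF G, of "\<eta> / 2"] \<eta>(1) by auto
  have c0: "0 < min (\<mu> / 2) \<eta>" using \<mu>(1) \<eta>(1) by simp
  obtain \<delta> where \<delta>: "0 < \<delta>"
    "\<And>x. infdist x X < \<delta> \<Longrightarrow> x \<in> N \<and> f x \<le> min (\<mu> / 2) \<eta> \<and> G x \<le> min (\<mu> / 2) \<eta>"
    using near_X[OF X N cl G on_X c0] by blast
  define c where "c = min (\<epsilon>' / 2) d / (2 * M)"
  have c: "0 < c" "M * c < \<epsilon>' / 2" "M * c < d"
    using \<epsilon>'(1) d(1) speed(1) by (auto simp: c_def min_def field_simps)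
  show "\<exists>\<delta>>0. \<exists>\<alpha>max>0. \<forall>\<alpha> x. (\<forall>k. 0 < \<alpha> k \<and> \<alpha> k \<le> \<alpha>max) \<and> euler_sequence F \<alpha> x \<and> x 0 \<in> tube \<delta> X
        \<longrightarrow> range x \<subseteq> tube \<epsilon> X"
  proof (rule exI[of _ \<delta>], intro conjI \<delta>(1), rule exI[of _ "min e (min s c)"], intro conjI allI impI)
    show "0 < min e (min s c)" using e s c by simp
    fix \<alpha> x
    assume *: "(\<forall>k. 0 < \<alpha> k \<and> \<alpha> k \<le> min e (min s c)) \<and> euler_sequence F \<alpha> x \<and> x 0 \<in> tube \<delta> X"
    then have \<alpha>: "\<And>i. 0 < \<alpha> i" "\<And>i. \<alpha> i \<le> e" "\<And>i. \<alpha> i \<le> s" "\<And>i. \<alpha> i \<le> c"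
      and eul: "euler_sequence F \<alpha> x" and x0: "infdist (x 0) X < \<delta>" by (auto simp: tube_def)
    have fk: "f (x k) \<le> \<mu>" if "\<forall>i\<le>k. x i \<in> N" for k
      by (rule e(2)[OF eul]) (use \<alpha> that \<delta>(2)[OF x0] in auto)
    \<comment> \<open>If \<open>G\<close> is at least \<open>\<eta> / 2\<close>, it does not
      increase in the next step; otherwise that step adds less than \<open>\<eta> / 2\<close>.
      Either way \<open>G\<close> stays at most \<open>\<eta>\<close>.\<close>
    have main: "(\<forall>i\<le>k. x i \<in> N) \<and> G (x k) \<le> \<eta>" for k
    proof (induction k)
      case 0
      then show ?case using \<delta>(2)[OF x0] by simp
    next
      case (Suc k)
      then have xk: "x k \<in> N" by blast
      have f: "f (x k) \<le> \<mu>" using fk Suc by blast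
      have "norm (x (Suc k) - x k) \<le> M * \<alpha> k" by (rule step_norm[OF eul \<alpha>(1) xk])
      also have "\<dots> \<le> M * c" using \<alpha>(4) speed by (intro mult_left_mono) auto
      finally have move: "norm (x (Suc k) - x k) \<le> M * c" .
      have "infdist (x (Suc k)) X \<le> infdist (x k) X + norm (x (Suc k) - x k)"
        using infdist_triangle[of "x (Suc k)" X "x k"] by (simp add: dist_norm)
      also have "\<dots> \<le> r" using \<eta>(2)[OF xk] f \<mu>(2) Suc move c(2) \<epsilon>'(3) by linarith
      finally have xS: "x (Suc k) \<in> N" by (simp add: N)
      have "G (x (Suc k)) \<le> \<eta>"
      proof (cases "\<eta> / 2 \<le> G (x k)")
        case True
        obtain u where "u \<in> F (x k)" "x (Suc k) = x k + \<alpha> k *\<^sub>R u"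
          using eul unfolding euler_sequence_def by blast
        then have "G (x (Suc k)) \<le> G (x k)"
          using s(2)[OF xk _ True \<alpha>(1) \<alpha>(3)] f \<mu>(3) xS by auto
        then show ?thesis using Suc by linarith
      next
        case False
        then show ?thesis using d(2)[OF xS xk] move c(3) by linarith
      qed
      then show ?case using Suc xS le_Suc_eq by metis
    qed
    show "range x \<subseteq> tube \<epsilon> X"
    proof (clarsimp simp: tube_def)
      fix k
      have "infdist (x k) X < \<epsilon>' / 2" using \<eta>(2)[of "x k"] main[of k] fk[of k] \<mu>(2) by auto
      then show "infdist (x k) X < \<epsilon>" using \<epsilon>' by linarith
    qed
  qed
qed

text \<open>Stability with radius \<open>r\<close> traps the iterates in \<open>N\<close>. Once
  \<open>f\<close> is small, each step with \<open>G\<close> at least \<open>\<eta> / 2\<close>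
  costs \<open>s * \<alpha> powr p\<close>; these costs have infinite sum, so \<open>G\<close> falls
  to \<open>\<eta>\<close>, and later steps cannot lift it above \<open>\<eta>\<close>.\<close>

lemma asymptotically_d_stable_argmin:
  assumes X: "X \<noteq> {}" "0 < r" and N: "N = {x. infdist x X \<le> r}" and cl: "closed X"
    and G: "continuous_on N G" and on_X: "\<And>x. x \<in> X \<Longrightarrow> f x = 0 \<and> G x \<le> 0"
    and zero: "\<And>x. \<lbrakk>x \<in> N; f x = 0; G x \<le> 0\<rbrakk> \<Longrightarrow> x \<in> X"
    and p: "1 \<le> p"
    and step: "\<And>\<eta>. 0 < \<eta> \<Longrightarrow> \<exists>s>0. \<forall>x\<in>N. f x \<le> s \<and> \<eta> \<le> G x \<longrightarrow>
       (\<forall>\<alpha> u. 0 < \<alpha> \<and> \<alpha> \<le> s \<and> u \<in> F x \<and> x + \<alpha> *\<^sub>R u \<in> N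
          \<longrightarrow> G (x + \<alpha> *\<^sub>R u) \<le> G x - s * \<alpha> powr p)"
  shows "asymptotically_p_d_stable p F X"
proof -
  have "d_stable F X"
  proof (rule d_stable_argmin[OF X N cl G on_X zero])
    fix \<eta> :: real assume "0 < \<eta>"
    from step[OF this] show "\<exists>s>0. \<forall>x\<in>N. f x \<le> s \<and> \<eta> \<le> G x \<longrightarrow>
       (\<forall>\<alpha> u. 0 < \<alpha> \<and> \<alpha> \<le> s \<and> u \<in> F x \<and> x + \<alpha> *\<^sub>R u \<in> N \<longrightarrow> G (x + \<alpha> *\<^sub>R u) \<le> G x)"
      by (smt (verit) mult_nonneg_nonneg powr_ge_zero)
  qed auto
  moreover from this X(2) obtain \<delta> \<alpha>0 where \<delta>: "0 < \<delta>" "0 < \<alpha>0"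
    "\<And>\<alpha> x. \<lbrakk>\<And>k. 0 < \<alpha> k \<and> \<alpha> k \<le> \<alpha>0; euler_sequence F \<alpha> x; x 0 \<in> tube \<delta> X\<rbrakk> \<Longrightarrow> range x \<subseteq> tube r X"
    unfolding d_stable_def by metis
  have "(\<lambda>k. infdist (x k) X) \<longlonglongrightarrow> 0"
    if *: "\<And>k. 0 < \<alpha> k \<and> \<alpha> k \<le> min \<alpha>0 1" "\<not> summable (\<lambda>k. \<alpha> k powr p)" "\<alpha> \<longlonglongrightarrow> 0"
      "euler_sequence F \<alpha> x" "x 0 \<in> tube \<delta> X" for \<alpha> x
  proof (rule LIMSEQ_I)
    fix \<epsilon> :: real assume "0 < \<epsilon>"
    have \<alpha>: "0 < \<alpha> k" "\<alpha> k \<le> \<alpha>0" "\<alpha> k \<le> 1" for k using *(1)[of k] by auto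
    have "range x \<subseteq> tube r X" by (rule \<delta>(3)[OF _ *(4,5)]) (use \<alpha> in auto)
    then have "infdist (x k) X < r" for k by (simp add: tube_def image_subset_iff)
    then have xN: "x k \<in> N" for k by (simp add: N less_imp_le)
    \<comment> \<open>The cap 1 on the steps is there for this comparison: divergence of the
      \<open>p\<close>-th powers then gives divergence of the steps themselves, as
      \<open>f_tendsto_0\<close> needs.\<close>
    have "\<alpha> k powr p \<le> \<alpha> k" for k using powr_mono'[OF p, of "\<alpha> k"] \<alpha>[of k] by simp
    then have "\<not> summable \<alpha>" using *(2) summable_comparison_test'[of \<alpha> 0 "\<lambda>k. \<alpha> k powr p"] by auto
    then have f0: "(\<lambda>k. f (x k)) \<longlonglongrightarrow> 0" using f_tendsto_0[OF *(4) \<alpha>(1) *(3)] xN by blast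
    obtain \<eta> where \<eta>: "0 < \<eta>" "\<And>x. \<lbrakk>x \<in> N; f x \<le> \<eta>; G x \<le> \<eta>\<rbrakk> \<Longrightarrow> infdist x X < \<epsilon>"
      using sublevel[OF G zero \<open>0 < \<epsilon>\<close>] by auto
    obtain s where s: "0 < s" "\<And>x \<alpha> u. \<lbrakk>x \<in> N; f x \<le> s; \<eta> / 2 \<le> G x; 0 < \<alpha>; \<alpha> \<le> s; u \<in> F x;
        x + \<alpha> *\<^sub>R u \<in> N\<rbrakk> \<Longrightarrow> G (x + \<alpha> *\<^sub>R u) \<le> G x - s * \<alpha> powr p"
      using step[of "\<eta> / 2"] \<eta>(1) by auto
    obtain d where d: "0 < d" "\<And>x y. x \<in> N \<Longrightarrow> y \<in> N \<Longrightarrow> norm (x - y) < d \<Longrightarrow> \<bar>G x - G y\<bar> < \<eta> / 2"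
      using uniform[OF G, of "\<eta> / 2"] \<eta>(1) by auto
    have "\<forall>\<^sub>F k in sequentially. f (x k) < min \<eta> s"
      by (rule order_tendstoD(2)[OF f0]) (use \<eta>(1) s(1) in simp)
    moreover have "\<forall>\<^sub>F k in sequentially. \<alpha> k < min s (d / M)"
      by (rule order_tendstoD(2)[OF *(3)]) (use d(1) s(1) speed(1) in simp)
    ultimately have "\<forall>\<^sub>F k in sequentially. f (x k) < min \<eta> s \<and> \<alpha> k < min s (d / M)"
      by (rule eventually_conj)
    then obtain K where "\<And>k. K \<le> k \<Longrightarrow> f (x k) < min \<eta> s \<and> \<alpha> k < min s (d / M)"
      unfolding eventually_sequentially by blast
    then have K: "f (x k) \<le> \<eta>" "f (x k) \<le> s" "\<alpha> k \<le> s" "\<alpha> k < d / M" if "K \<le> k" for k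
      using that less_imp_le by auto
    have dec: "G (x (Suc k)) \<le> G (x k) - s * \<alpha> k powr p" if "K \<le> k" "\<eta> / 2 \<le> G (x k)" for k
    proof -
      obtain u where "u \<in> F (x k)" "x (Suc k) = x k + \<alpha> k *\<^sub>R u"
        using *(4) unfolding euler_sequence_def by blast
      then show ?thesis using s(2)[OF xN K(2)[OF that(1)] that(2) \<alpha>(1) K(3)[OF that(1)]] xN[of "Suc k"] by auto
    qed
    have "\<exists>k\<ge>K. G (x k) \<le> \<eta>"
    proof (rule ccontr)
      assume "\<not> ?thesis"
      then have big: "\<eta> < G (x k)" if "K \<le> k" for k using that by force
      have sum: "G (x k) \<le> G (x K) - s * (\<Sum>i=K..<k. \<alpha> i powr p)" if "K \<le> k" for k
        using that
      proof (induction k rule: dec_induct)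
        case (step k)
        then show ?case using dec[of k] big[of k] \<eta>(1) by (simp add: distrib_left)
      qed simp
      obtain m where m: "(G (x K) + 1) / s \<le> (\<Sum>i=K..<m. \<alpha> i powr p)"
        using not_summable_unbounded[of "\<lambda>k. \<alpha> k powr p"] *(2) by (metis powr_ge_zero)
      then have m': "G (x K) + 1 \<le> s * (\<Sum>i=K..<m. \<alpha> i powr p)"
        using s(1) by (simp add: field_simps)
      show False
      \<comment> \<open>For \<open>m < K\<close> the sum is empty and \<open>m'\<close> reads
        \<open>G (x K) + 1 \<le> 0\<close>, which contradicts \<open>big\<close>.\<close>
      proof (cases "K \<le> m")
        case True
        then show False using sum[OF True] m' big[OF True] \<eta>(1) by linarith
      next
        case False
        then show False using m' big[of K] \<eta>(1) by simp
      qed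
    qed
    then obtain k where k: "K \<le> k" "G (x k) \<le> \<eta>" by blast
    have "G (x i) \<le> \<eta>" if "k \<le> i" for i
      using that
    proof (induction i rule: dec_induct)
      case (step i)
      show ?case
      proof (cases "\<eta> / 2 \<le> G (x i)")
        case True
        moreover have "0 \<le> s * \<alpha> i powr p" using s(1) by simp
        ultimately show ?thesis using dec[of i] step k by linarith
      next
        case False
        have "norm (x (Suc i) - x i) \<le> M * \<alpha> i" by (rule step_norm[OF *(4) \<alpha>(1) xN])
        also have "\<dots> < d" using K(4)[of i] step k speed(1) by (simp add: field_simps)
        finally show ?thesis using d(2)[OF xN[of "Suc i"] xN[of i]] False by linarith
      qed
    qed (rule k(2))
    then have "infdist (x i) X < \<epsilon>" if "k \<le> i" for i
      using \<eta>(2)[OF xN[of i]] K(1)[of i] k that by auto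
    then show "\<exists>no. \<forall>k\<ge>no. norm (infdist (x k) X - 0) < \<epsilon>" by (auto simp: infdist_nonneg)
  qed
  ultimately show ?thesis unfolding asymptotically_p_d_stable_def
    using \<delta>(1,2) by (intro conjI exI[of _ \<delta>] exI[of _ "min \<alpha>0 1"]) auto
qed

end

subsection \<open>The Lyapunov conditions\<close>

text \<open>The definition speaks of whole Euler sequences. Any single step extends to one with
  constant step size by selecting elements of the nonempty values of \<open>F\<close>.\<close>

lemma d_lyapunov_on_step:
  assumes ne: "\<And>x. F x \<noteq> {}" and "d_lyapunov_on F g W"
  obtains s where "0 < s" "\<And>x \<alpha> u. \<lbrakk>x \<in> W; 0 < \<alpha>; \<alpha> \<le> s; u \<in> F x\<rbrakk> \<Longrightarrow> g (x + \<alpha> *\<^sub>R u) \<le> g x"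
proof -
  obtain s where s: "0 < s" "\<And>\<alpha> x k. \<lbrakk>\<And>k. 0 < \<alpha> k \<and> \<alpha> k \<le> s; euler_sequence F \<alpha> x; x k \<in> W\<rbrakk>
      \<Longrightarrow> g (x (Suc k)) \<le> g (x k)"
    using assms(2) unfolding d_lyapunov_on_def by metis
  define v where "v x = (SOME u. u \<in> F x)" for x
  have v: "v x \<in> F x" for x using ne[of x] by (simp add: v_def some_in_eq)
  show thesis
  proof (rule that[OF s(1)])
    fix x \<alpha> u assume *: "x \<in> W" "0 < \<alpha>" "\<alpha> \<le> s" "u \<in> F x"
    \<comment> \<open>The first step uses the prescribed \<open>u\<close>, all later ones the
      selection \<open>v\<close>.\<close>
    define y where "y k = (case k of 0 \<Rightarrow> x | Suc j \<Rightarrow> ((\<lambda>z. z + \<alpha> *\<^sub>R v z) ^^ j) (x + \<alpha> *\<^sub>R u))" for k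
    have "euler_sequence F (\<lambda>_. \<alpha>) y"
      unfolding euler_sequence_def
    proof
      fix k show "\<exists>u\<in>F (y k). y (Suc k) = y k + \<alpha> *\<^sub>R u"
        using *(4) v by (cases k) (auto simp: y_def)
    qed
    from s(2)[OF _ this, of 0] show "g (x + \<alpha> *\<^sub>R u) \<le> g x" using * by (simp add: y_def)
  qed
qed

lemma compact_superlevel:
  fixes G :: "'a::t2_space \<Rightarrow> real"
  assumes "compact N" "continuous_on N G"
  shows "compact {x \<in> N. a \<le> G x}"
proof -
  have "closedin (top_of_set N) (N \<inter> G -` {a..})"
    by (rule continuous_closedin_preimage[OF assms(2)]) simp
  then show ?thesis using closedin_compact[OF assms(1)] by (simp add: vimage_def Int_def)
qed

text \<open>Here \<open>infdist x {}\<close> is 0, so every tube of positive radius is the whole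
  space.\<close>

lemma stable_empty: "d_stable F {}" "asymptotically_p_d_stable p F {}"
proof -
  show "d_stable F {}" unfolding d_stable_def by (auto simp: tube_def infdist_def intro!: exI[of _ 1])
  then show "asymptotically_p_d_stable p F {}"
    unfolding asymptotically_p_d_stable_def by (auto simp: infdist_def intro!: exI[of _ 1])
qed

section \<open>Reduction of the theorem to the discrete argument\<close>

theorem theorem3p13:
  fixes F D :: "real ^ 'n \<Rightarrow> (real ^ 'n) set"
    and f :: "real ^ 'n \<Rightarrow> real"
    and g :: "real ^ 'n \<Rightarrow> ereal"
    and p l :: real
  assumes F_usc: "upper_semicontinuous F"
    and F_values: "\<And>x. F x \<noteq> {} \<and> compact (F x)"
    and potential: "conservative_field f D"
    and descent: "\<And>z. \<exists>\<rho>>0. \<exists>\<kappa>\<in>class_P. \<forall>x\<in>ball z \<rho>.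
          (SUP u\<in>convex hull F x. INF v\<in>D x. u \<bullet> v) \<le> - (INF w\<in>D x. \<kappa> w)"
    and level: "0 < l" "\<not> (\<exists>x. 0 \<in> D x \<and> f x \<in> {0<..<l})"
    and min_f: "has_minimum f 0"
    and p: "1 \<le> p"
    and g_proper: "\<And>x. g x \<noteq> - \<infinity>"
    and g_cont: "\<exists>V. open V \<and> argmin f \<subseteq> V \<and> continuous_on V g"
    and min_g: "has_minimum g 0"
    and bdd: "bounded (argmin (\<lambda>x. ereal (f x) + g x))"
    and minimizers: "argmin (\<lambda>x. ereal (f x) + g x) \<subseteq> argmin f"
  shows "((\<exists>U. open U \<and> argmin (\<lambda>x. ereal (f x) + g x) \<subseteq> U \<and>
             (\<forall>z \<in> argmin f \<inter> {x. g x > 0} \<inter> U.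
                \<exists>W. open W \<and> z \<in> W \<and> d_lyapunov_on F g W))
          \<longrightarrow> d_stable F (argmin (\<lambda>x. ereal (f x) + g x)))
       \<and> ((\<exists>U. open U \<and> argmin (\<lambda>x. ereal (f x) + g x) \<subseteq> U \<and>
             (\<forall>z \<in> argmin f \<inter> {x. g x > 0} \<inter> U.
                \<exists>W. open W \<and> z \<in> W \<and> p_d_lyapunov_on p F g W))
          \<longrightarrow> asymptotically_p_d_stable p F (argmin (\<lambda>x. ereal (f x) + g x)))"
proof -
  define X where "X = argmin (\<lambda>x. ereal (f x) + g x)"
  show ?thesis
  proof (cases "X = {}")
    case True
    then show ?thesis using stable_empty(1)[of F] stable_empty(2)[of p F] unfolding X_def by simp
  next
    case False
    have f0: "0 \<le> f x" for x using min_f by (simp add: has_minimum_def)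
    have argmin_f: "argmin f = {x. f x = 0}"
      using min_f unfolding argmin_def has_minimum_def by auto (metis order_antisym)
    have g0: "0 \<le> g x" for x using min_g by (simp add: has_minimum_def)
    obtain xg where xg: "g xg = 0" using min_g by (auto simp: has_minimum_def)
    have cont: "continuous_on UNIV f"
      using potential locally_lipschitz_continuous_on by (auto simp: conservative_field_def)
    obtain x1 where x1: "x1 \<in> X" using False by blast
    have fX: "f x = 0" if "x \<in> X" for x using that minimizers argmin_f by (auto simp: X_def)
    \<comment> \<open>Comparison with a zero of \<open>g\<close> shows that \<open>g\<close> is
      finite at the minimizer \<open>x1\<close>.\<close>
    have "ereal (f x1) + g x1 \<le> ereal (f xg) + g xg" using x1 by (simp add: X_def argmin_def)
    then have "g x1 \<le> ereal (f xg)" using fX[OF x1] xg by (simp add: zero_ereal_def[symmetric])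
    then obtain c where c: "g x1 = ereal c" using g_proper[of x1] by (cases "g x1") auto
    have c0: "0 \<le> c" using g0[of x1] c by simp
    have X_iff: "x \<in> X \<longleftrightarrow> f x = 0 \<and> g x = ereal c" for x
    proof
      assume x: "x \<in> X"
      then have "ereal (f x) + g x = ereal (f x1) + g x1"
        using x1 by (auto simp: X_def argmin_def intro: antisym)
      then show "f x = 0 \<and> g x = ereal c" using fX[OF x] fX[OF x1] c by (simp add: zero_ereal_def[symmetric])
    next
      assume "f x = 0 \<and> g x = ereal c"
      then show "x \<in> X" using x1 fX[OF x1] c by (simp add: X_def argmin_def)
    qed
    have g_ge: "ereal c \<le> g x" if "f x = 0" for x
    proof -
      have "ereal (f x1) + g x1 \<le> ereal (f x) + g x" using x1 by (simp add: X_def argmin_def)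
      then show ?thesis using that fX[OF x1] c by (simp add: zero_ereal_def[symmetric])
    qed
    obtain V where V: "open V" "argmin f \<subseteq> V" "continuous_on V g" using g_cont by blast
    have "closed (argmin f)"
      unfolding argmin_f using continuous_closed_vimage[of "{0}" f] cont
      by (simp add: vimage_def continuous_on_eq_continuous_at)
    \<comment> \<open>Continuity of \<open>g\<close> is available only near \<open>argmin f\<close>,
      so the preimage is taken within this closed set.\<close>
    then have "closed (argmin f \<inter> g -` {ereal c})"
      by (intro continuous_closed_preimage continuous_on_subset[OF V(3,2)]) auto
    also have "argmin f \<inter> g -` {ereal c} = X" by (auto simp: X_iff argmin_f)
    finally have clX: "closed X" .
    then have cX: "compact X" using bdd by (simp add: X_def compact_eq_bounded_closed)
    \<comment> \<open>\<open>G\<close> may be negative where \<open>f\<close> is positive, but by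
      \<open>g_ge\<close> not where \<open>f\<close> vanishes and \<open>g\<close> is finite. Hence
      \<open>f x = 0\<close> and \<open>G x \<le> 0\<close> together characterise \<open>X\<close>
      inside the tube.\<close>
    define G where "G x = real_of_ereal (g x) - c" for x
    define N where "N r = {x. infdist x X \<le> r}" for r
    have region: "\<exists>r M. 0 < r \<and> N r \<subseteq> U \<and> euler_descent F f (N r) M \<and> continuous_on (N r) G \<and>
        (\<forall>x\<in>N r. g x = ereal (G x + c))" if U: "open U" "X \<subseteq> U" for U
    proof -
      \<comment> \<open>The bound \<open>c + 1\<close> makes \<open>g\<close> finite, so that
        \<open>G\<close> is a continuous real function; the bound \<open>l\<close> keeps 0 out of
        \<open>D\<close> wherever \<open>f\<close> is positive.\<close>
      define B where "B = U \<inter> (V \<inter> g -` {..<ereal (c + 1)}) \<inter> (f -` {..<l})"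
      have "open (V \<inter> g -` {..<ereal (c + 1)})"
        by (rule continuous_open_preimage) (use V in auto)
      moreover have "open (f -` {..<l})"
        using continuous_open_vimage[of "{..<l}" f] cont by (simp add: continuous_on_eq_continuous_at)
      ultimately have "open B" using U unfolding B_def by blast
      moreover have "X \<subseteq> B" using U V level(1) by (auto simp: B_def X_iff argmin_f)
      ultimately obtain r where r: "0 < r" "N r \<subseteq> B"
        using compact_in_open_separated[OF False cX] unfolding N_def by metis
      have cN: "compact (N r)" unfolding N_def by (rule compact_infdist_le[OF False cX r(1)])
      have gN: "g x = ereal (G x + c)" if "x \<in> N r" for x
      proof -
        have "g x < ereal (c + 1)" using that r by (auto simp: B_def)
        then show ?thesis using g0[of x] by (cases "g x") (auto simp: G_def)
      qed
      have "continuous_on (N r) (real_of_ereal \<circ> g)"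
      proof (rule continuous_on_compose)
        show "continuous_on (N r) g" by (rule continuous_on_subset[OF V(3)]) (use r in \<open>auto simp: B_def\<close>)
        show "continuous_on (g ` N r) real_of_ereal"
          by (rule continuous_on_subset[OF continuous_on_real]) (use gN in auto)
      qed
      then have cG: "continuous_on (N r) G" unfolding G_def by (auto simp: o_def intro!: continuous_intros)
      obtain M where M: "0 < M" "\<And>x u. x \<in> N r \<Longrightarrow> u \<in> F x \<Longrightarrow> norm u \<le> M"
        using upper_semicontinuous_bounded[OF F_usc _ cN] F_values by metis
      have "euler_descent F f (N r) M"
      proof
        show "continuous_on (N r) f" using cont continuous_on_subset by blast
        fix a T :: real assume aT: "0 < a" "0 < T" "T \<le> 1"
        have "compact {x \<in> N r. a \<le> f x}"
          by (rule compact_superlevel[OF cN continuous_on_subset[OF cont]]) simp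
        moreover have "0 \<notin> D z" if "z \<in> {x \<in> N r. a \<le> f x}" for z
          using that r(2) aT(1) level(2) by (force simp: B_def)
        moreover have "\<exists>\<kappa>\<in>class_P. (SUP u\<in>convex hull F z. INF v\<in>D z. u \<bullet> v) \<le> - (INF w\<in>D z. \<kappa> w)" for z
          using descent[of z] by (meson centre_in_ball)
        ultimately show "\<exists>e>0. \<forall>\<alpha> x k. euler_arc F e \<alpha> x k \<and> (\<forall>i\<le>k. x i \<in> {x \<in> N r. a \<le> f x}) \<and>
            T \<le> (\<Sum>i<k. \<alpha> i) \<and> (\<Sum>i<k. \<alpha> i) \<le> T + e \<longrightarrow> f (x k) \<le> f (x 0) - e"
          by (intro euler_uniform_descent[OF F_usc F_values potential _ _ _ aT(2,3)])
      qed (use cN M f0 in auto)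
      then show ?thesis using r cG gN by (intro exI[of _ r] exI[of _ M]) (auto simp: B_def)
    qed
    have on_X: "f x = 0 \<and> G x \<le> 0" if "x \<in> X" for x using that by (simp add: X_iff G_def)
    show ?thesis
    proof (fold X_def, intro conjI impI; elim exE conjE)
      fix U assume U: "open U" "X \<subseteq> U" and lyap: "\<forall>z \<in> argmin f \<inter> {x. g x > 0} \<inter> U.
                \<exists>W. open W \<and> z \<in> W \<and> d_lyapunov_on F g W"
      from region[OF U] obtain r M where r: "0 < r" "N r \<subseteq> U" "euler_descent F f (N r) M"
        "continuous_on (N r) G" and gN: "\<And>x. x \<in> N r \<Longrightarrow> g x = ereal (G x + c)" by metis
      interpret euler_descent F f "N r" M by (rule r(3))
      have zero: "x \<in> X" if "x \<in> N r" "f x = 0" "G x \<le> 0" for x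
        using g_ge[OF that(2)] gN[OF that(1)] that by (simp add: X_iff)
      let ?P = "\<lambda>x s. \<forall>\<alpha> u. 0 < \<alpha> \<and> \<alpha> \<le> s \<and> u \<in> F x \<longrightarrow> g (x + \<alpha> *\<^sub>R u) \<le> g x"
      show "d_stable F X"
      proof (rule d_stable_argmin[OF False r(1) N_def clX r(4) on_X zero])
        fix \<eta> :: real assume \<eta>: "0 < \<eta>"
        obtain s where s: "0 < s" "\<And>x. \<lbrakk>x \<in> {x \<in> N r. \<eta> \<le> G x}; f x \<le> s\<rbrakk> \<Longrightarrow> ?P x s"
        proof (rule compact_near_zero_set[of "{x \<in> N r. \<eta> \<le> G x}" f ?P])
          show "continuous_on {x \<in> N r. \<eta> \<le> G x} f" using cont continuous_on_subset by blast
          show "?P x s'" if "?P x s" "s' \<le> s" for x s s' using that by force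
          show "compact {x \<in> N r. \<eta> \<le> G x}" by (rule compact_superlevel[OF compact_N r(4)])
          fix z assume z: "z \<in> {x \<in> N r. \<eta> \<le> G x}" "f z \<le> 0"
          \<comment> \<open>At such a point \<open>f\<close> vanishes and
            \<open>g z = G z + c\<close> is at least \<open>\<eta>\<close>, since \<open>c\<close>
            is nonnegative.\<close>
          then have "z \<in> argmin f \<inter> {x. g x > 0} \<inter> U"
            using r(2) f0[of z] gN[of z] \<eta> c0 by (auto simp: argmin_f)
          then obtain W where W: "open W" "z \<in> W" "d_lyapunov_on F g W" using lyap by blast
          obtain s where "0 < s" "\<And>x \<alpha> u. \<lbrakk>x \<in> W; 0 < \<alpha>; \<alpha> \<le> s; u \<in> F x\<rbrakk> \<Longrightarrow> g (x + \<alpha> *\<^sub>R u) \<le> g x"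
            using d_lyapunov_on_step[OF _ W(3)] F_values by metis
          then show "\<exists>W s. open W \<and> z \<in> W \<and> 0 < s \<and> (\<forall>x\<in>W. ?P x s)"
            using W by blast
        qed (use that in blast)
        \<comment> \<open>Both ends of the step lie in the tube, where \<open>g\<close> is
          \<open>G + c\<close>, so the extended inequality becomes a real one.\<close>
        show "\<exists>s>0. \<forall>x\<in>N r. f x \<le> s \<and> \<eta> \<le> G x \<longrightarrow> (\<forall>\<alpha> u. 0 < \<alpha> \<and> \<alpha> \<le> s \<and> u \<in> F x \<and>
            x + \<alpha> *\<^sub>R u \<in> N r \<longrightarrow> G (x + \<alpha> *\<^sub>R u) \<le> G x)"
          using s gN by (intro exI[of _ s]) (fastforce simp: gN)
      qed
    next
      fix U assume U: "open U" "X \<subseteq> U" and lyap: "\<forall>z \<in> argmin f \<inter> {x. g x > 0} \<inter> U.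
                \<exists>W. open W \<and> z \<in> W \<and> p_d_lyapunov_on p F g W"
      from region[OF U] obtain r M where r: "0 < r" "N r \<subseteq> U" "euler_descent F f (N r) M"
        "continuous_on (N r) G" and gN: "\<And>x. x \<in> N r \<Longrightarrow> g x = ereal (G x + c)" by metis
      interpret euler_descent F f "N r" M by (rule r(3))
      have zero: "x \<in> X" if "x \<in> N r" "f x = 0" "G x \<le> 0" for x
        using g_ge[OF that(2)] gN[OF that(1)] that by (simp add: X_iff)
      let ?P = "\<lambda>x s. \<forall>\<alpha> u. 0 < \<alpha> \<and> \<alpha> \<le> s \<and> u \<in> F x \<longrightarrow>
            g (x + \<alpha> *\<^sub>R u) - g x \<le> - ereal (s * \<alpha> powr p)"
      \<comment> \<open>Lowering the rate weakens the decrease condition, so one number can serve as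
        step bound, rate and threshold for \<open>f\<close>; locally it is
        \<open>min a w\<close>.\<close>
      have weaken: "- ereal (s * \<alpha> powr p) \<le> - ereal (s' * \<alpha> powr p)" if "s' \<le> s" for s s' \<alpha>
        using that by (simp add: mult_right_mono)
      show "asymptotically_p_d_stable p F X"
      proof (rule asymptotically_d_stable_argmin[OF False r(1) N_def clX r(4) on_X zero p])
        fix \<eta> :: real assume \<eta>: "0 < \<eta>"
        obtain s where s: "0 < s" "\<And>x. \<lbrakk>x \<in> {x \<in> N r. \<eta> \<le> G x}; f x \<le> s\<rbrakk> \<Longrightarrow> ?P x s"
        proof (rule compact_near_zero_set[of "{x \<in> N r. \<eta> \<le> G x}" f ?P])
          show "compact {x \<in> N r. \<eta> \<le> G x}" by (rule compact_superlevel[OF compact_N r(4)])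
          show "continuous_on {x \<in> N r. \<eta> \<le> G x} f" using cont continuous_on_subset by blast
          show "?P x s'" if "?P x s" "s' \<le> s" for x s s'
            using that order_trans[OF _ weaken[OF that(2)]] by force
          fix z assume z: "z \<in> {x \<in> N r. \<eta> \<le> G x}" "f z \<le> 0"
          then have "z \<in> argmin f \<inter> {x. g x > 0} \<inter> U"
            using r(2) f0[of z] gN[of z] \<eta> c0 by (auto simp: argmin_f)
          then obtain W where W: "open W" "z \<in> W" "p_d_lyapunov_on p F g W" using lyap by blast
          then obtain a w where aw: "0 < a" "0 < w" and dec: "\<And>\<alpha> x u. \<lbrakk>0 < \<alpha>; \<alpha> \<le> a; x \<in> W; u \<in> F x\<rbrakk> \<Longrightarrow>
              g (x + \<alpha> *\<^sub>R u) - g x \<le> - ereal (w * \<alpha> powr p)"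
            unfolding p_d_lyapunov_on_def by metis
          have "?P x (min a w)" if "x \<in> W" for x
            using that order_trans[OF dec weaken[of "min a w" w]] by simp
          then show "\<exists>W s. open W \<and> z \<in> W \<and> 0 < s \<and> (\<forall>x\<in>W. ?P x s)"
            using W aw by (intro exI[of _ W] exI[of _ "min a w"]) auto
        qed (use that in blast)
        have "G (x + \<alpha> *\<^sub>R u) \<le> G x - s * \<alpha> powr p"
          if "x \<in> N r" "f x \<le> s" "\<eta> \<le> G x" "0 < \<alpha>" "\<alpha> \<le> s" "u \<in> F x" "x + \<alpha> *\<^sub>R u \<in> N r" for x \<alpha> u
          using s(2)[of x] that gN[OF that(1)] gN[OF that(7)] by force
        then show "\<exists>s>0. \<forall>x\<in>N r. f x \<le> s \<and> \<eta> \<le> G x \<longrightarrow> (\<forall>\<alpha> u. 0 < \<alpha> \<and> \<alpha> \<le> s \<and> u \<in> F x \<and>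
            x + \<alpha> *\<^sub>R u \<in> N r \<longrightarrow> G (x + \<alpha> *\<^sub>R u) \<le> G x - s * \<alpha> powr p)"
          using s(1) by blast
      qed
    qed
  qed
qed

end
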